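(* Let $R$ be a ring with unity, let $\mathcal{X}$ be a semibrick of left $R$-modules and let $M$ be an $\mathcal{X}$-semisimple module. Suppose $M=\bigoplus_{i\in I}M_i$, where each $M_i$ is isomorphic to a brick in $\mathcal{X}$. (a) Let $U$ be a finitely presented $\mathcal{X}$-semisimple submodule of $M$. Then there exists a subset $I'\subseteq I$ such that $M=\bigoplus_{i\in I'}M_i\oplus U$. (b) Let $V$ be a submodule of $M$ which is isomorphic to a brick in $\mathcal{X}$, and let $U$ be an $\mathcal{X}$-semisimple submodule of $M$. If $V\cap U\ne0$, then $V\subseteq U$.
   Context: A brick is a finitely presented left $R$-module whose endomorphism ring is a division ring. A semibrick is a class $\mathcal{X}$ of pairwise non-isomorphic bricks with $\mathrm{Hom}(X,X')=0$ for distinct $X,X'\in\mathcal{X}$. A module is $\mathcal{X}$-semisimple if it is isomorphic to a (possibly empty or infinite) direct sum of objects from $\mathcal{X}$ (repetitions allowed). The direct sum decompositions of $M$ are internal. *)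

theory Defs
  imports "HOL-Algebra.Module"
begin

text \<open>
  The locale \<open>module\<close> of HOL-Algebra demands a commutative ring. We use its record type and its
  locale \<open>submodule\<close>, which needs no commutativity, and restate the axioms over an arbitrary ring
  with unity. The ring components \<open>mult\<close> and \<open>one\<close> of the record play no role for modules.
\<close>

locale left_module = R?: ring R + M?: abelian_group M
  for R :: "('a, 'r) ring_scheme" (structure) and M :: "('a, 'b, 'm) module_scheme" (structure) +
  assumes smult_closed:
      "\<lbrakk>a \<in> carrier R; x \<in> carrier M\<rbrakk> \<Longrightarrow> a \<odot>\<^bsub>M\<^esub> x \<in> carrier M"
    and smult_l_distr:
      "\<lbrakk>a \<in> carrier R; b \<in> carrier R; x \<in> carrier M\<rbrakk>
        \<Longrightarrow> (a \<oplus>\<^bsub>R\<^esub> b) \<odot>\<^bsub>M\<^esub> x = a \<odot>\<^bsub>M\<^esub> x \<oplus>\<^bsub>M\<^esub> b \<odot>\<^bsub>M\<^esub> x"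
    and smult_r_distr:
      "\<lbrakk>a \<in> carrier R; x \<in> carrier M; y \<in> carrier M\<rbrakk>
        \<Longrightarrow> a \<odot>\<^bsub>M\<^esub> (x \<oplus>\<^bsub>M\<^esub> y) = a \<odot>\<^bsub>M\<^esub> x \<oplus>\<^bsub>M\<^esub> a \<odot>\<^bsub>M\<^esub> y"
    and smult_assoc:
      "\<lbrakk>a \<in> carrier R; b \<in> carrier R; x \<in> carrier M\<rbrakk>
        \<Longrightarrow> (a \<otimes>\<^bsub>R\<^esub> b) \<odot>\<^bsub>M\<^esub> x = a \<odot>\<^bsub>M\<^esub> (b \<odot>\<^bsub>M\<^esub> x)"
    and smult_one:
      "x \<in> carrier M \<Longrightarrow> \<one>\<^bsub>R\<^esub> \<odot>\<^bsub>M\<^esub> x = x"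

text \<open>Homomorphisms are extensional, so that equality of functions is equality of homomorphisms.\<close>

definition mod_hom ::
  "('a, 'r) ring_scheme \<Rightarrow> ('a, 'b, 'm) module_scheme \<Rightarrow> ('a, 'c, 'n) module_scheme \<Rightarrow> ('b \<Rightarrow> 'c) set"
  where "mod_hom R M N =
    {f \<in> carrier M \<rightarrow>\<^sub>E carrier N.
      (\<forall>x\<in>carrier M. \<forall>y\<in>carrier M. f (x \<oplus>\<^bsub>M\<^esub> y) = f x \<oplus>\<^bsub>N\<^esub> f y) \<and>
      (\<forall>a\<in>carrier R. \<forall>x\<in>carrier M. f (a \<odot>\<^bsub>M\<^esub> x) = a \<odot>\<^bsub>N\<^esub> f x)}"

definition zero_hom ::
  "('a, 'b, 'm) module_scheme \<Rightarrow> ('a, 'c, 'n) module_scheme \<Rightarrow> 'b \<Rightarrow> 'c"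
  where "zero_hom M N = (\<lambda>x\<in>carrier M. \<zero>\<^bsub>N\<^esub>)"

definition mod_isomorphic ::
  "('a, 'r) ring_scheme \<Rightarrow> ('a, 'b, 'm) module_scheme \<Rightarrow> ('a, 'c, 'n) module_scheme \<Rightarrow> bool"
  where "mod_isomorphic R M N \<longleftrightarrow>
    (\<exists>f\<in>mod_hom R M N. bij_betw f (carrier M) (carrier N))"

definition endo_ring :: "('a, 'r) ring_scheme \<Rightarrow> ('a, 'b, 'm) module_scheme \<Rightarrow> ('b \<Rightarrow> 'b) ring"
  where "endo_ring R M =
    \<lparr>carrier = mod_hom R M M,
     mult = compose (carrier M),
     one = (\<lambda>x\<in>carrier M. x),
     zero = zero_hom M M,
     add = (\<lambda>f g. \<lambda>x\<in>carrier M. f x \<oplus>\<^bsub>M\<^esub> g x)\<rparr>"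

locale division_ring = ring +
  assumes one_not_zero: "\<one> \<noteq> \<zero>"
    and nonzero_Units: "carrier R - {\<zero>} \<subseteq> Units R"

definition regular_module :: "('a, 'r) ring_scheme \<Rightarrow> ('a, 'a) module"
  where "regular_module R =
    \<lparr>carrier = carrier R, mult = mult R, one = one R, zero = zero R, add = add R,
     smult = mult R\<rparr>"

definition direct_sum :: "'i set \<Rightarrow> ('i \<Rightarrow> ('a, 'b, 'm) module_scheme) \<Rightarrow> ('a, 'i \<Rightarrow> 'b) module"
  where "direct_sum I F =
    \<lparr>carrier = {x \<in> \<Pi>\<^sub>E i\<in>I. carrier (F i). finite {i \<in> I. x i \<noteq> \<zero>\<^bsub>F i\<^esub>}},
     mult = undefined, one = undefined,
     zero = (\<lambda>i\<in>I. \<zero>\<^bsub>F i\<^esub>),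
     add = (\<lambda>x y. \<lambda>i\<in>I. x i \<oplus>\<^bsub>F i\<^esub> y i),
     smult = (\<lambda>a x. \<lambda>i\<in>I. a \<odot>\<^bsub>F i\<^esub> x i)\<rparr>"

abbreviation free_module :: "('a, 'r) ring_scheme \<Rightarrow> nat \<Rightarrow> ('a, nat \<Rightarrow> 'a) module"
  where "free_module R n \<equiv> direct_sum {..<n} (\<lambda>_. regular_module R)"

text \<open>There is an exact sequence \<open>R\<^sup>m \<rightarrow> R\<^sup>n \<rightarrow> M \<rightarrow> 0\<close>.\<close>

definition finitely_presented :: "('a, 'r) ring_scheme \<Rightarrow> ('a, 'b, 'm) module_scheme \<Rightarrow> bool"
  where "finitely_presented R M \<longleftrightarrow>
    (\<exists>m n. \<exists>f\<in>mod_hom R (free_module R m) (free_module R n). \<exists>g\<in>mod_hom R (free_module R n) M.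
       g ` carrier (free_module R n) = carrier M \<and>
       f ` carrier (free_module R m) = {x \<in> carrier (free_module R n). g x = \<zero>\<^bsub>M\<^esub>})"

definition brick :: "('a, 'r) ring_scheme \<Rightarrow> ('a, 'b, 'm) module_scheme \<Rightarrow> bool"
  where "brick R M \<longleftrightarrow>
    left_module R M \<and> finitely_presented R M \<and> division_ring (endo_ring R M)"

definition semibrick :: "('a, 'r) ring_scheme \<Rightarrow> ('a, 'b, 'm) module_scheme set \<Rightarrow> bool"
  where "semibrick R \<X> \<longleftrightarrow>
    (\<forall>X\<in>\<X>. brick R X) \<and>
    (\<forall>X\<in>\<X>. \<forall>X'\<in>\<X>. X \<noteq> X' \<longrightarrow> \<not> mod_isomorphic R X X' \<and> mod_hom R X X' = {zero_hom X X'})"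

text \<open>
  A definition cannot quantify over the type of the index set, so the index sets of the direct sums
  are taken inside the element type of \<open>M\<close>. For a semibrick this is no restriction, because its
  members are nonzero: see \<open>semisimpleI\<close> below.
\<close>

definition semisimple ::
  "('a, 'r) ring_scheme \<Rightarrow> ('a, 'b, 'm) module_scheme set \<Rightarrow> ('a, 'c, 'n) module_scheme \<Rightarrow> bool"
  where "semisimple R \<X> M \<longleftrightarrow>
    (\<exists>(J :: 'c set) F. F \<in> J \<rightarrow> \<X> \<and> mod_isomorphic R M (direct_sum J F))"

text \<open>
  \<open>M\<close> is the internal direct sum of the submodules \<open>N i\<close>: the summation map from the external
  direct sum to \<open>M\<close> is bijective.
\<close>

definition internal_direct_sum ::
  "('a, 'r) ring_scheme \<Rightarrow> ('a, 'b, 'm) module_scheme \<Rightarrow> 'i set \<Rightarrow> ('i \<Rightarrow> 'b set) \<Rightarrow> bool"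
  where "internal_direct_sum R M I N \<longleftrightarrow>
    (\<forall>i\<in>I. submodule (N i) R M) \<and>
    bij_betw (\<lambda>x. finsum M x {i \<in> I. x i \<noteq> \<zero>\<^bsub>M\<^esub>})
      (carrier (direct_sum I (\<lambda>i. M\<lparr>carrier := N i\<rparr>))) (carrier M)"

lemma brick_nonzero:
  assumes "brick R X"
  shows "\<exists>x\<in>carrier X. x \<noteq> \<zero>\<^bsub>X\<^esub>"
proof (rule ccontr)
  assume "\<not> ?thesis"
  then have "(\<lambda>x\<in>carrier X. x) = (\<lambda>x\<in>carrier X. \<zero>\<^bsub>X\<^esub>)" by (auto simp: restrict_def)
  then have "\<one>\<^bsub>endo_ring R X\<^esub> = \<zero>\<^bsub>endo_ring R X\<^esub>" by (simp add: endo_ring_def zero_hom_def)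
  with assms show False
    by (auto simp: brick_def division_ring_def division_ring_axioms_def)
qed

lemma mod_isomorphic_reindex:
  fixes F :: "'j \<Rightarrow> ('a, 'b, 'm) module_scheme"
  assumes M: "left_module R M" and iso: "mod_isomorphic R M (direct_sum J F)" and b: "bij_betw p K J"
  shows "mod_isomorphic R M (direct_sum K (F \<circ> p))"
proof -
  obtain h where h: "h \<in> mod_hom R M (direct_sum J F)"
    and hb: "bij_betw h (carrier M) (carrier (direct_sum J F))"
    using iso unfolding mod_isomorphic_def by blast
  have pK: "p k \<in> J" if "k \<in> K" for k using b that by (auto simp: bij_betw_def)
  define q where "q = inv_into K p"
  have q: "q j \<in> K" "p (q j) = j" if "j \<in> J" for j
    using b that unfolding q_def
    by (auto simp: bij_betw_def inv_into_into f_inv_into_f)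
  have qp: "q (p k) = k" if "k \<in> K" for k
    using b that unfolding q_def by (auto simp: bij_betw_def)
  define T where "T = (\<lambda>x. \<lambda>k\<in>K. x (p k) :: 'b)"
  define S where "S = (\<lambda>y. \<lambda>j\<in>J. y (q j) :: 'b)"
  have T: "T x \<in> carrier (direct_sum K (F \<circ> p))" if x: "x \<in> carrier (direct_sum J F)" for x
  proof -
    have "{k \<in> K. x (p k) \<noteq> \<zero>\<^bsub>F (p k)\<^esub>} \<subseteq> q ` {j \<in> J. x j \<noteq> \<zero>\<^bsub>F j\<^esub>}"
      using pK qp by (force simp: image_iff)
    then have "finite {k \<in> K. x (p k) \<noteq> \<zero>\<^bsub>F (p k)\<^esub>}"
      using x by (auto simp: direct_sum_def intro: finite_subset)
    moreover have "{k \<in> K. T x k \<noteq> \<zero>\<^bsub>F (p k)\<^esub>} = {k \<in> K. x (p k) \<noteq> \<zero>\<^bsub>F (p k)\<^esub>}"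
      by (auto simp: T_def)
    ultimately show ?thesis using x pK by (auto simp: direct_sum_def T_def)
  qed
  have S: "S y \<in> carrier (direct_sum J F)" if y: "y \<in> carrier (direct_sum K (F \<circ> p))" for y
  proof -
    have "{j \<in> J. y (q j) \<noteq> \<zero>\<^bsub>F j\<^esub>} \<subseteq> p ` {k \<in> K. y k \<noteq> \<zero>\<^bsub>F (p k)\<^esub>}"
      using q by (force simp: image_iff)
    then have "finite {j \<in> J. y (q j) \<noteq> \<zero>\<^bsub>F j\<^esub>}"
      using y by (auto simp: direct_sum_def intro: finite_subset)
    moreover have "{j \<in> J. S y j \<noteq> \<zero>\<^bsub>F j\<^esub>} = {j \<in> J. y (q j) \<noteq> \<zero>\<^bsub>F j\<^esub>}"
      by (auto simp: S_def)
    moreover have "y (q j) \<in> carrier (F j)" if "j \<in> J" for j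
      using y q[OF that] by (fastforce simp: direct_sum_def PiE_iff)
    ultimately show ?thesis by (auto simp: direct_sum_def S_def)
  qed
  have ST: "S (T x) = x" if "x \<in> carrier (direct_sum J F)" for x
    using that q by (auto simp: direct_sum_def S_def T_def PiE_iff extensional_def fun_eq_iff)
  have TS: "T (S y) = y" if "y \<in> carrier (direct_sum K (F \<circ> p))" for y
    using that pK qp by (auto simp: direct_sum_def S_def T_def PiE_iff extensional_def fun_eq_iff)
  have Tb: "bij_betw T (carrier (direct_sum J F)) (carrier (direct_sum K (F \<circ> p)))"
    by (rule bij_betw_byWitness[of _ S]) (use ST TS T S in auto)
  have hc: "h x \<in> carrier (direct_sum J F)" if "x \<in> carrier M" for x
    using h that by (auto simp: mod_hom_def)
  let ?g = "compose (carrier M) T h"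
  have "bij_betw ?g (carrier M) (carrier (direct_sum K (F \<circ> p)))"
    using bij_betw_compose[OF hb Tb] .
  moreover have "?g \<in> mod_hom R M (direct_sum K (F \<circ> p))"
  proof -
    have add: "T (x \<oplus>\<^bsub>direct_sum J F\<^esub> y) = T x \<oplus>\<^bsub>direct_sum K (F \<circ> p)\<^esub> T y" for x y
      using pK by (auto simp: direct_sum_def T_def fun_eq_iff)
    have sm: "T (a \<odot>\<^bsub>direct_sum J F\<^esub> x) = a \<odot>\<^bsub>direct_sum K (F \<circ> p)\<^esub> T x" for a x
      using pK by (auto simp: direct_sum_def T_def fun_eq_iff)
    have "?g \<in> carrier M \<rightarrow>\<^sub>E carrier (direct_sum K (F \<circ> p))"
      using T hc by (auto simp: compose_def)
    moreover have "x \<oplus>\<^bsub>M\<^esub> y \<in> carrier M" if "x \<in> carrier M" "y \<in> carrier M" for x y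
      using that abelian_groupE(1)[OF left_module.axioms(2)[OF M]] by blast
    moreover have "a \<odot>\<^bsub>M\<^esub> x \<in> carrier M" if "a \<in> carrier R" "x \<in> carrier M" for a x
      using left_module.smult_closed[OF M that] .
    ultimately show ?thesis
      using h add sm unfolding mod_hom_def compose_def by simp
  qed
  ultimately show ?thesis unfolding mod_isomorphic_def by blast
qed

lemma semisimpleI:
  fixes J :: "'j set"
  assumes X: "semibrick R \<X>" and M: "left_module R M"
    and F: "F \<in> J \<rightarrow> \<X>" and iso: "mod_isomorphic R M (direct_sum J F)"
  shows "semisimple R \<X> M"
proof -
  obtain h where hb: "bij_betw h (carrier M) (carrier (direct_sum J F))"
    using iso unfolding mod_isomorphic_def by blast
  have "\<forall>j\<in>J. \<exists>x\<in>carrier (F j). x \<noteq> \<zero>\<^bsub>F j\<^esub>"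
    using X F brick_nonzero unfolding semibrick_def by blast
  then obtain e where e: "\<And>j. j \<in> J \<Longrightarrow> e j \<in> carrier (F j) \<and> e j \<noteq> \<zero>\<^bsub>F j\<^esub>"
    by metis
  define d where "d = (\<lambda>j. \<lambda>i\<in>J. if i = j then e j else \<zero>\<^bsub>F i\<^esub>)"
  have z: "\<zero>\<^bsub>F i\<^esub> \<in> carrier (F i)" if "i \<in> J" for i
  proof -
    have "left_module R (F i)" using X F that unfolding semibrick_def brick_def by blast
    then show ?thesis by (meson left_module.axioms(2) abelian_groupE(2))
  qed
  have dc: "d j \<in> carrier (direct_sum J F)" if "j \<in> J" for j
  proof -
    have "{i \<in> J. d j i \<noteq> \<zero>\<^bsub>F i\<^esub>} \<subseteq> {j}" by (auto simp: d_def)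
    then have "finite {i \<in> J. d j i \<noteq> \<zero>\<^bsub>F i\<^esub>}" by (rule finite_subset) simp
    then show ?thesis using e z by (auto simp: direct_sum_def d_def)
  qed
  have dinj: "inj_on d J"
  proof (rule inj_onI)
    fix j k assume jk: "j \<in> J" "k \<in> J" "d j = d k"
    then have "d j j = d k j" by simp
    then show "j = k" using jk(1,2) e[of j] by (auto simp: d_def split: if_splits)
  qed
  define \<phi> where "\<phi> = inv_into (carrier M) h \<circ> d"
  have "inj_on (inv_into (carrier M) h) (d ` J)"
    using dc hb by (intro inj_on_inv_into) (auto simp: bij_betw_def)
  then have "bij_betw \<phi> J (\<phi> ` J)"
    unfolding \<phi>_def using dinj comp_inj_on by (blast intro: inj_on_imp_bij_betw)
  then have b: "bij_betw (inv_into J \<phi>) (\<phi> ` J) J" by (rule bij_betw_inv_into)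
  have "F \<circ> inv_into J \<phi> \<in> \<phi> ` J \<rightarrow> \<X>"
    using F b by (auto simp: bij_betw_def inv_into_into)
  with mod_isomorphic_reindex[OF M iso b] show ?thesis
    unfolding semisimple_def by blast
qed

end

theory Submission
  imports Defs
begin

text \<open>
  By Schur's lemma a homomorphism between modules isomorphic to members of a semibrick is zero or
  bijective. Hence a Steinitz exchange works: if \<open>M = \<Oplus>\<^bsub>i\<in>I'\<^esub> M\<^sub>i \<oplus> U\<close> and \<open>V\<close> is isomorphic to a brick and
  not contained in \<open>U\<close>, then some coordinate map \<open>V \<rightarrow> M\<^sub>i\<close> with \<open>i \<in> I'\<close> is nonzero, thus bijective.
  So \<open>V \<inter> U = 0\<close>, and \<open>V\<close> can take the place of \<open>M\<^sub>i\<close>. Starting from \<open>U = 0\<close>, every finite partial sum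
  of the bricks in an \<open>\<X>\<close>-semisimple submodule is complemented by some \<open>\<Oplus>\<^bsub>i\<in>I'\<^esub> M\<^sub>i\<close>. For (a), a finitely
  generated submodule is such a partial sum. For (b), take a finite partial sum of \<open>U\<close> that contains a
  nonzero element of \<open>V \<inter> U\<close>; it must contain \<open>V\<close>.
\<close>

section \<open>Linear maps\<close>

text \<open>Extensionality, which \<open>mod_hom\<close> demands, is dropped, so that composites and
  lambda terms are linear maps without being restricted to a carrier.\<close>

definition linear_map ::
  "('a, 'r) ring_scheme \<Rightarrow> ('a, 'b, 'm) module_scheme \<Rightarrow> ('a, 'c, 'n) module_scheme \<Rightarrow> ('b \<Rightarrow> 'c) \<Rightarrow> bool"
  where "linear_map R A B f \<longleftrightarrow>
    f \<in> carrier A \<rightarrow> carrier B \<and>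
    (\<forall>x\<in>carrier A. \<forall>y\<in>carrier A. f (x \<oplus>\<^bsub>A\<^esub> y) = f x \<oplus>\<^bsub>B\<^esub> f y) \<and>
    (\<forall>a\<in>carrier R. \<forall>x\<in>carrier A. f (a \<odot>\<^bsub>A\<^esub> x) = a \<odot>\<^bsub>B\<^esub> f x)"

lemma linear_mapI:
  assumes "\<And>x. x \<in> carrier A \<Longrightarrow> f x \<in> carrier B"
    and "\<And>x y. x \<in> carrier A \<Longrightarrow> y \<in> carrier A \<Longrightarrow> f (x \<oplus>\<^bsub>A\<^esub> y) = f x \<oplus>\<^bsub>B\<^esub> f y"
    and "\<And>a x. a \<in> carrier R \<Longrightarrow> x \<in> carrier A \<Longrightarrow> f (a \<odot>\<^bsub>A\<^esub> x) = a \<odot>\<^bsub>B\<^esub> f x"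
  shows "linear_map R A B f"
  using assms unfolding linear_map_def by blast

lemma linear_mapD:
  assumes "linear_map R A B f"
  shows "x \<in> carrier A \<Longrightarrow> f x \<in> carrier B"
    and "x \<in> carrier A \<Longrightarrow> y \<in> carrier A \<Longrightarrow> f (x \<oplus>\<^bsub>A\<^esub> y) = f x \<oplus>\<^bsub>B\<^esub> f y"
    and "a \<in> carrier R \<Longrightarrow> x \<in> carrier A \<Longrightarrow> f (a \<odot>\<^bsub>A\<^esub> x) = a \<odot>\<^bsub>B\<^esub> f x"
  using assms unfolding linear_map_def by auto

lemma mod_hom_linear_map: "f \<in> mod_hom R A B \<Longrightarrow> linear_map R A B f"
  unfolding mod_hom_def linear_map_def by auto

lemma left_module_add_closed:
  "left_module R A \<Longrightarrow> x \<in> carrier A \<Longrightarrow> y \<in> carrier A \<Longrightarrow> x \<oplus>\<^bsub>A\<^esub> y \<in> carrier A"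
  by (meson left_module.axioms(2) abelian_groupE(1))

lemma left_module_zero_closed: "left_module R A \<Longrightarrow> \<zero>\<^bsub>A\<^esub> \<in> carrier A"
  by (meson left_module.axioms(2) abelian_groupE(2))

text \<open>The way back to extensional homomorphisms. Sums and multiples stay in the carrier of
  \<open>A\<close>, so the restriction does not disturb the linearity equations.\<close>

lemma linear_map_mod_hom:
  assumes "left_module R A" "linear_map R A B f"
  shows "restrict f (carrier A) \<in> mod_hom R A B"
  using assms(2) left_module_add_closed[OF assms(1)] left_module.smult_closed[OF assms(1)]
  unfolding mod_hom_def linear_map_def by auto

lemma linear_map_compose:
  "linear_map R A B f \<Longrightarrow> linear_map R B C g \<Longrightarrow> linear_map R A C (\<lambda>x. g (f x))"
  unfolding linear_map_def by (auto simp: Pi_iff)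

lemma linear_map_inv_into:
  assumes A: "left_module R A" and f: "linear_map R A B f"
    and b: "bij_betw f (carrier A) (carrier B)"
  shows "linear_map R B A (inv_into (carrier A) f)" (is "linear_map R B A ?g")
proof -
  note b' = bij_betw_inv_into_left[OF b] bij_betw_inv_into_right[OF b]
  have g: "?g x \<in> carrier A" if "x \<in> carrier B" for x
    using b that by (metis bij_betw_def inv_into_into)
  show ?thesis
  proof (rule linear_mapI)
    fix x y assume xy: "x \<in> carrier B" "y \<in> carrier B"
    have "?g x \<oplus>\<^bsub>A\<^esub> ?g y \<in> carrier A"
      using left_module_add_closed[OF A] g xy by blast
    moreover have "f (?g x \<oplus>\<^bsub>A\<^esub> ?g y) = x \<oplus>\<^bsub>B\<^esub> y"
      using linear_mapD(2)[OF f] g xy b' by simp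
    ultimately show "?g (x \<oplus>\<^bsub>B\<^esub> y) = ?g x \<oplus>\<^bsub>A\<^esub> ?g y"
      using b'(1) by metis
  next
    fix a x assume ax: "a \<in> carrier R" "x \<in> carrier B"
    have "a \<odot>\<^bsub>A\<^esub> ?g x \<in> carrier A"
      using left_module.smult_closed[OF A] g ax by blast
    moreover have "f (a \<odot>\<^bsub>A\<^esub> ?g x) = a \<odot>\<^bsub>B\<^esub> x"
      using linear_mapD(3)[OF f] g ax b' by simp
    ultimately show "?g (a \<odot>\<^bsub>B\<^esub> x) = a \<odot>\<^bsub>A\<^esub> ?g x"
      using b'(1) by metis
  qed (rule g)
qed

lemma linear_map_zero:
  assumes A: "left_module R A" and B: "left_module R B" and f: "linear_map R A B f"
  shows "f \<zero>\<^bsub>A\<^esub> = \<zero>\<^bsub>B\<^esub>"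
proof -
  interpret A: abelian_group A using left_module.axioms(2)[OF A] .
  interpret B: abelian_group B using left_module.axioms(2)[OF B] .
  have "f \<zero>\<^bsub>A\<^esub> \<oplus>\<^bsub>B\<^esub> f \<zero>\<^bsub>A\<^esub> = f \<zero>\<^bsub>A\<^esub>"
    using linear_mapD(2)[OF f A.zero_closed A.zero_closed] by simp
  then show ?thesis using linear_mapD(1)[OF f A.zero_closed]
    by (metis B.add.r_cancel_one)
qed

section \<open>Schur's lemma for semibricks\<close>

text \<open>A nonzero endomorphism is a unit of the endomorphism ring, and a two-sided inverse under
  composition is an inverse function.\<close>

lemma brick_endomorphism:
  assumes X: "brick R X" and f: "f \<in> mod_hom R X X"
  shows "f = zero_hom X X \<or> bij_betw f (carrier X) (carrier X)"
proof (rule disjCI)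
  assume nb: "\<not> bij_betw f (carrier X) (carrier X)"
  show "f = zero_hom X X"
  proof (rule ccontr)
    assume "f \<noteq> zero_hom X X"
    moreover have "division_ring (endo_ring R X)" using X by (simp add: brick_def)
    ultimately have "f \<in> Units (endo_ring R X)"
      using division_ring.nonzero_Units f by (fastforce simp: endo_ring_def)
    then obtain g where g: "g \<in> mod_hom R X X"
      and gf: "compose (carrier X) g f = (\<lambda>x\<in>carrier X. x)"
      and fg: "compose (carrier X) f g = (\<lambda>x\<in>carrier X. x)"
      by (auto simp: Units_def endo_ring_def)
    have "g (f x) = x" "f (g x) = x" if "x \<in> carrier X" for x
      using that gf fg by (metis compose_eq restrict_apply')+
    with f g have "bij_betw f (carrier X) (carrier X)"
      by (intro bij_betw_byWitness[of _ g]) (auto simp: mod_hom_def)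
    with nb show False by blast
  qed
qed

text \<open>Isomorphisms of \<open>A\<close> and \<open>B\<close> with members \<open>X\<close> and
  \<open>Y\<close> of the semibrick turn \<open>f\<close> into a homomorphism \<open>g\<close> from
  \<open>X\<close> to \<open>Y\<close>. If \<open>X = Y\<close>, it is an endomorphism of a brick;
  otherwise the zero map is the only homomorphism. Either outcome is carried back to
  \<open>f\<close>.\<close>

lemma semibrick_schur:
  assumes S: "semibrick R \<X>" and A: "left_module R A" and B: "left_module R B"
    and AX: "\<exists>X\<in>\<X>. mod_isomorphic R A X" and BX: "\<exists>X\<in>\<X>. mod_isomorphic R B X"
    and f: "linear_map R A B f"
  shows "(\<forall>x\<in>carrier A. f x = \<zero>\<^bsub>B\<^esub>) \<or> bij_betw f (carrier A) (carrier B)"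
proof -
  obtain X p where X: "X \<in> \<X>" and p: "p \<in> mod_hom R A X"
    and pb: "bij_betw p (carrier A) (carrier X)"
    using AX unfolding mod_isomorphic_def by blast
  obtain Y q where Y: "Y \<in> \<X>" and q: "q \<in> mod_hom R B Y"
    and qb: "bij_betw q (carrier B) (carrier Y)"
    using BX unfolding mod_isomorphic_def by blast
  have Xb: "brick R X" and Xm: "left_module R X" and Ym: "left_module R Y"
    using S X Y unfolding semibrick_def brick_def by auto
  note p = mod_hom_linear_map[OF p] and q = mod_hom_linear_map[OF q]
  let ?p' = "inv_into (carrier A) p"
  define g where "g = restrict (\<lambda>x. q (f (?p' x))) (carrier X)"
  have g: "g \<in> mod_hom R X Y"
    unfolding g_def
    by (rule linear_map_mod_hom[OF Xm
          linear_map_compose[OF linear_map_compose[OF linear_map_inv_into[OF A p pb] f] q]])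
  have gp: "g (p x) = q (f x)" if "x \<in> carrier A" for x
    using that bij_betw_inv_into_left[OF pb that] linear_mapD(1)[OF p that] by (simp add: g_def)
  consider "g = zero_hom X Y" | "bij_betw g (carrier X) (carrier Y)"
  proof (cases "X = Y")
    case True
    then show ?thesis using that brick_endomorphism[OF Xb] g by blast
  next
    case False
    then have "mod_hom R X Y = {zero_hom X Y}" using S X Y unfolding semibrick_def by blast
    then show ?thesis using that g by blast
  qed
  then show ?thesis
  proof cases
    case 1
    have "f x = \<zero>\<^bsub>B\<^esub>" if x: "x \<in> carrier A" for x
    proof -
      have "q (f x) = q \<zero>\<^bsub>B\<^esub>"
        using gp[OF x] 1 linear_mapD(1)[OF p x] linear_map_zero[OF B Ym q]
        by (simp add: zero_hom_def)
      then show ?thesis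
        using qb linear_mapD(1)[OF f x] left_module_zero_closed[OF B]
        by (metis bij_betw_def inj_onD)
    qed
    then show ?thesis by blast
  next
    case 2
    \<comment> \<open>Bijectivity passes from \<open>g\<close> to the composite of \<open>p\<close>
      and \<open>g\<close>, which is that of \<open>f\<close> and \<open>q\<close>; composing with
      the inverse of \<open>q\<close> leaves \<open>f\<close>.\<close>
    have "bij_betw (\<lambda>x. g (p x)) (carrier A) (carrier Y)"
      using bij_betw_trans[OF pb 2] by (simp add: comp_def)
    then have "bij_betw (\<lambda>x. q (f x)) (carrier A) (carrier Y)"
      using gp by (simp cong: bij_betw_cong)
    then have "bij_betw (\<lambda>x. inv_into (carrier B) q (q (f x))) (carrier A) (carrier B)"
      using bij_betw_trans[OF _ bij_betw_inv_into[OF qb]] by (fastforce simp: comp_def)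
    moreover have "inv_into (carrier B) q (q (f x)) = f x" if "x \<in> carrier A" for x
      using bij_betw_inv_into_left[OF qb] linear_mapD(1)[OF f that] by blast
    ultimately show ?thesis by (simp cong: bij_betw_cong)
  qed
qed

section \<open>Scalars, submodules and unique decompositions\<close>

context left_module
begin

lemma smult_zero_right:
  assumes "a \<in> carrier R" shows "a \<odot>\<^bsub>M\<^esub> \<zero>\<^bsub>M\<^esub> = \<zero>\<^bsub>M\<^esub>"
proof -
  have "a \<odot>\<^bsub>M\<^esub> \<zero>\<^bsub>M\<^esub> \<oplus>\<^bsub>M\<^esub> a \<odot>\<^bsub>M\<^esub> \<zero>\<^bsub>M\<^esub> = a \<odot>\<^bsub>M\<^esub> \<zero>\<^bsub>M\<^esub>"
    using smult_r_distr[OF assms M.zero_closed M.zero_closed] by simp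
  then show ?thesis using smult_closed[OF assms M.zero_closed] by (metis M.add.r_cancel_one)
qed

lemma smult_zero_left:
  assumes "x \<in> carrier M" shows "\<zero>\<^bsub>R\<^esub> \<odot>\<^bsub>M\<^esub> x = \<zero>\<^bsub>M\<^esub>"
proof -
  have "\<zero>\<^bsub>R\<^esub> \<odot>\<^bsub>M\<^esub> x \<oplus>\<^bsub>M\<^esub> \<zero>\<^bsub>R\<^esub> \<odot>\<^bsub>M\<^esub> x = \<zero>\<^bsub>R\<^esub> \<odot>\<^bsub>M\<^esub> x"
    using smult_l_distr[OF R.zero_closed R.zero_closed assms] by simp
  then show ?thesis using smult_closed[OF R.zero_closed assms] by (metis M.add.r_cancel_one)
qed

text \<open>Reduces negation to the scalar action: closure of a subset under scalars gives closure
  under negation, and linear maps respect differences.\<close>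

lemma smult_minus_one:
  assumes "x \<in> carrier M" shows "(\<ominus>\<^bsub>R\<^esub> \<one>\<^bsub>R\<^esub>) \<odot>\<^bsub>M\<^esub> x = \<ominus>\<^bsub>M\<^esub> x"
proof -
  have "(\<ominus>\<^bsub>R\<^esub> \<one>\<^bsub>R\<^esub>) \<odot>\<^bsub>M\<^esub> x \<oplus>\<^bsub>M\<^esub> x = \<zero>\<^bsub>M\<^esub>"
    using smult_l_distr[of "\<ominus>\<^bsub>R\<^esub> \<one>\<^bsub>R\<^esub>" "\<one>\<^bsub>R\<^esub>" x] assms smult_one[OF assms]
    by (simp add: R.l_neg smult_zero_left)
  then show ?thesis
    using assms smult_closed[of "\<ominus>\<^bsub>R\<^esub> \<one>\<^bsub>R\<^esub>" x] M.minus_equality by force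
qed

lemma smult_sum:
  assumes "a \<in> carrier R" "finite A" "x \<in> A \<rightarrow> carrier M"
  shows "a \<odot>\<^bsub>M\<^esub> finsum M x A = finsum M (\<lambda>i. a \<odot>\<^bsub>M\<^esub> x i) A"
  using assms(2,3)
proof (induction A rule: finite_induct)
  case empty
  then show ?case by (simp add: smult_zero_right assms(1))
next
  case (insert i A)
  then have "finsum M x A \<in> carrier M" by (intro M.finsum_closed) auto
  with insert show ?case
    by (simp add: Pi_iff smult_closed smult_r_distr assms(1))
qed

text \<open>Closure under negation comes from the scalar -1.\<close>

lemma submodule_intro:
  assumes "H \<subseteq> carrier M" and "\<zero>\<^bsub>M\<^esub> \<in> H"
    and add: "\<And>x y. x \<in> H \<Longrightarrow> y \<in> H \<Longrightarrow> x \<oplus>\<^bsub>M\<^esub> y \<in> H"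
    and smult: "\<And>a x. a \<in> carrier R \<Longrightarrow> x \<in> H \<Longrightarrow> a \<odot>\<^bsub>M\<^esub> x \<in> H"
  shows "submodule H R M"
proof (intro submodule.intro subgroup.intro submodule_axioms.intro)
  fix x assume "x \<in> H"
  then have "\<ominus>\<^bsub>M\<^esub> x \<in> H"
    using smult[of "\<ominus>\<^bsub>R\<^esub> \<one>\<^bsub>R\<^esub>" x] smult_minus_one[of x] assms(1) by auto
  then show "inv\<^bsub>add_monoid M\<^esub> x \<in> H" by (simp add: a_inv_def)
qed (use assms in auto)

lemma submodule_closed:
  assumes "submodule H R M"
  shows "x \<in> H \<Longrightarrow> x \<in> carrier M" and "\<zero>\<^bsub>M\<^esub> \<in> H"
    and "x \<in> H \<Longrightarrow> y \<in> H \<Longrightarrow> x \<oplus>\<^bsub>M\<^esub> y \<in> H"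
    and "x \<in> H \<Longrightarrow> \<ominus>\<^bsub>M\<^esub> x \<in> H"
    and "x \<in> H \<Longrightarrow> y \<in> H \<Longrightarrow> x \<ominus>\<^bsub>M\<^esub> y \<in> H"
    and "a \<in> carrier R \<Longrightarrow> x \<in> H \<Longrightarrow> a \<odot>\<^bsub>M\<^esub> x \<in> H"
proof -
  have sg: "subgroup H (add_monoid M)" using assms by (rule submodule.axioms)
  show "x \<in> H \<Longrightarrow> x \<in> carrier M" using subgroup.subset[OF sg] by auto
  show "\<zero>\<^bsub>M\<^esub> \<in> H" using subgroup.one_closed[OF sg] by simp
  show add: "x \<in> H \<Longrightarrow> y \<in> H \<Longrightarrow> x \<oplus>\<^bsub>M\<^esub> y \<in> H" for x y
    using subgroup.m_closed[OF sg] by simp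
  show neg: "x \<in> H \<Longrightarrow> \<ominus>\<^bsub>M\<^esub> x \<in> H" for x
    using subgroup.m_inv_closed[OF sg] by (simp add: a_inv_def)
  show "x \<in> H \<Longrightarrow> y \<in> H \<Longrightarrow> x \<ominus>\<^bsub>M\<^esub> y \<in> H"
    using add neg by (simp add: a_minus_def)
  show "a \<in> carrier R \<Longrightarrow> x \<in> H \<Longrightarrow> a \<odot>\<^bsub>M\<^esub> x \<in> H"
    by (rule submodule.smult_closed[OF assms])
qed

lemma left_module_submodule:
  assumes H: "submodule H R M"
  shows "left_module R (M\<lparr>carrier := H\<rparr>)"
proof -
  note c = submodule_closed[OF H]
  have "abelian_group (M\<lparr>carrier := H\<rparr>)"
  proof (rule abelian_groupI)
    fix x assume "x \<in> carrier (M\<lparr>carrier := H\<rparr>)"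
    then have "\<ominus>\<^bsub>M\<^esub> x \<in> H \<and> \<ominus>\<^bsub>M\<^esub> x \<oplus>\<^bsub>M\<^esub> x = \<zero>\<^bsub>M\<^esub>"
      using c by (simp add: M.l_neg)
    then show "\<exists>y\<in>carrier (M\<lparr>carrier := H\<rparr>). y \<oplus>\<^bsub>M\<lparr>carrier := H\<rparr>\<^esub> x = \<zero>\<^bsub>M\<lparr>carrier := H\<rparr>\<^esub>"
      by auto
  qed (use c in \<open>auto simp: M.a_ac\<close>)
  then show ?thesis
    using c by (intro left_module.intro left_module_axioms.intro R.ring_axioms)
      (auto simp: smult_l_distr smult_r_distr smult_assoc smult_one)
qed

text \<open>The element a - a' = b' - b lies in both submodules, hence is zero.\<close>

lemma disjoint_sum_unique:
  assumes "submodule A R M" "submodule B R M" "A \<inter> B = {\<zero>\<^bsub>M\<^esub>}"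
    and "a \<in> A" "a' \<in> A" "b \<in> B" "b' \<in> B" "a \<oplus>\<^bsub>M\<^esub> b = a' \<oplus>\<^bsub>M\<^esub> b'"
  shows "a = a' \<and> b = b'"
proof -
  note A = submodule_closed[OF assms(1)] and B = submodule_closed[OF assms(2)]
  have m: "a \<in> carrier M" "a' \<in> carrier M" "b \<in> carrier M" "b' \<in> carrier M"
    using A(1) B(1) assms(4-7) by auto
  have "a \<ominus>\<^bsub>M\<^esub> a' = b' \<ominus>\<^bsub>M\<^esub> b"
  proof -
    have "b' = \<ominus>\<^bsub>M\<^esub> a' \<oplus>\<^bsub>M\<^esub> (a \<oplus>\<^bsub>M\<^esub> b)"
      using m assms(8) by (simp add: M.r_neg1)
    then have "b' \<ominus>\<^bsub>M\<^esub> b = \<ominus>\<^bsub>M\<^esub> a' \<oplus>\<^bsub>M\<^esub> (a \<oplus>\<^bsub>M\<^esub> (b \<oplus>\<^bsub>M\<^esub> \<ominus>\<^bsub>M\<^esub> b))"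
      using m by (simp add: M.a_assoc M.minus_eq)
    then show ?thesis using m by (simp add: M.r_neg M.minus_eq M.a_comm)
  qed
  then have "a \<ominus>\<^bsub>M\<^esub> a' = \<zero>\<^bsub>M\<^esub>" using A(5)[OF assms(4,5)] B(5)[OF assms(7,6)] assms(3) by auto
  then have "a = a'" using m M.minus_equality[of a "\<ominus>\<^bsub>M\<^esub> a'"] by (simp add: M.minus_eq)
  then show ?thesis using assms(8) m by simp
qed

end

lemma linear_map_minus:
  assumes A: "left_module R A" and B: "left_module R B" and f: "linear_map R A B f"
    and x: "x \<in> carrier A" and y: "y \<in> carrier A"
  shows "f (x \<ominus>\<^bsub>A\<^esub> y) = f x \<ominus>\<^bsub>B\<^esub> f y"
proof -
  interpret A: left_module R A by (rule A)
  interpret B: left_module R B by (rule B)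
  have "f (\<ominus>\<^bsub>A\<^esub> y) = \<ominus>\<^bsub>B\<^esub> f y"
    using linear_mapD(3)[OF f, of "\<ominus>\<^bsub>R\<^esub> \<one>\<^bsub>R\<^esub>" y] linear_mapD(1)[OF f y] y
    by (simp add: A.smult_minus_one B.smult_minus_one)
  then show ?thesis using linear_mapD(2)[OF f x, of "\<ominus>\<^bsub>A\<^esub> y"] y
    by (simp add: A.M.minus_eq B.M.minus_eq)
qed

section \<open>Complements and projections\<close>

context left_module
begin

lemma linear_map_into_submodule:
  "submodule H R M \<Longrightarrow> linear_map R A (M\<lparr>carrier := H\<rparr>) f \<Longrightarrow> linear_map R A M f"
  using submodule_closed(1) by (fastforce simp: linear_map_def)

lemma linear_map_from_submodule:
  "submodule H R M \<Longrightarrow> linear_map R M B f \<Longrightarrow> linear_map R (M\<lparr>carrier := H\<rparr>) B f"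
  using submodule_closed(1) by (fastforce simp: linear_map_def)

lemma left_module_self: "left_module R M" ..

text \<open>For submodules this says that M is the internal direct sum of A and B. The binary form
  suits the exchange induction; \<open>internal_direct_sum_complement\<close> turns it into an
  indexed direct sum afterwards.\<close>

definition complementary :: "'b set \<Rightarrow> 'b set \<Rightarrow> bool" where
  "complementary A B \<longleftrightarrow>
    A \<inter> B = {\<zero>\<^bsub>M\<^esub>} \<and> (\<forall>x\<in>carrier M. \<exists>a\<in>A. \<exists>b\<in>B. a \<oplus>\<^bsub>M\<^esub> b = x)"

text \<open>The map \<open>q\<close> is the projection onto A along B. It is linear because
  decompositions are unique and the sum or a multiple of decompositions is again a
  decomposition.\<close>

lemma complementary_projection:
  assumes A: "submodule A R M" and B: "submodule B R M" and AB: "complementary A B"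
  obtains q where "linear_map R M (M\<lparr>carrier := A\<rparr>) q"
    and "\<And>x. x \<in> carrier M \<Longrightarrow> \<exists>b\<in>B. q x \<oplus>\<^bsub>M\<^esub> b = x"
    and "\<And>b. b \<in> B \<Longrightarrow> q b = \<zero>\<^bsub>M\<^esub>"
proof -
  note cA = submodule_closed[OF A] and cB = submodule_closed[OF B]
  have "\<forall>x\<in>carrier M. \<exists>a. a \<in> A \<and> (\<exists>b\<in>B. a \<oplus>\<^bsub>M\<^esub> b = x)"
    using AB unfolding complementary_def by blast
  then obtain q where q: "\<And>x. x \<in> carrier M \<Longrightarrow> q x \<in> A \<and> (\<exists>b\<in>B. q x \<oplus>\<^bsub>M\<^esub> b = x)"
    by metis
  have uniq: "q x = a" if "a \<in> A" "b \<in> B" "x = a \<oplus>\<^bsub>M\<^esub> b" for x a b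
  proof -
    have "x \<in> carrier M" using that cA(1) cB(1) by simp
    then obtain b' where "b' \<in> B" "q x \<oplus>\<^bsub>M\<^esub> b' = x" and "q x \<in> A" using q by blast
    then show ?thesis using disjoint_sum_unique[OF A B, of "q x" a b' b] AB that
      unfolding complementary_def by metis
  qed
  have "linear_map R M (M\<lparr>carrier := A\<rparr>) q"
  proof (rule linear_mapI)
    fix x y assume xy: "x \<in> carrier M" "y \<in> carrier M"
    obtain b where b: "b \<in> B" "q x \<oplus>\<^bsub>M\<^esub> b = x" using q xy by blast
    obtain d where d: "d \<in> B" "q y \<oplus>\<^bsub>M\<^esub> d = y" using q xy by blast
    have m: "q x \<in> carrier M" "q y \<in> carrier M" "b \<in> carrier M" "d \<in> carrier M"
      using q xy b d cA(1) cB(1) by auto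
    have "x \<oplus>\<^bsub>M\<^esub> y = (q x \<oplus>\<^bsub>M\<^esub> b) \<oplus>\<^bsub>M\<^esub> (q y \<oplus>\<^bsub>M\<^esub> d)" using b d by simp
    also have "\<dots> = (q x \<oplus>\<^bsub>M\<^esub> q y) \<oplus>\<^bsub>M\<^esub> (b \<oplus>\<^bsub>M\<^esub> d)" using m by (simp add: M.a_ac)
    finally have "q (x \<oplus>\<^bsub>M\<^esub> y) = q x \<oplus>\<^bsub>M\<^esub> q y"
      by (rule uniq[OF cA(3) cB(3), rotated 4]) (use q xy b(1) d(1) in blast)+
    then show "q (x \<oplus>\<^bsub>M\<^esub> y) = q x \<oplus>\<^bsub>M\<lparr>carrier := A\<rparr>\<^esub> q y" by simp
  next
    fix a x assume ax: "a \<in> carrier R" "x \<in> carrier M"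
    obtain b where b: "b \<in> B" "q x \<oplus>\<^bsub>M\<^esub> b = x" using q ax by blast
    have m: "q x \<in> carrier M" "b \<in> carrier M" using q ax b cA(1) cB(1) by auto
    have "a \<odot>\<^bsub>M\<^esub> x = a \<odot>\<^bsub>M\<^esub> q x \<oplus>\<^bsub>M\<^esub> a \<odot>\<^bsub>M\<^esub> b"
      using b(2) smult_r_distr[OF ax(1) m] by simp
    then have "q (a \<odot>\<^bsub>M\<^esub> x) = a \<odot>\<^bsub>M\<^esub> q x"
      by (rule uniq[OF cA(6)[OF ax(1)] cB(6)[OF ax(1)], rotated 2]) (use q ax b(1) in blast)+
    then show "q (a \<odot>\<^bsub>M\<^esub> x) = a \<odot>\<^bsub>M\<lparr>carrier := A\<rparr>\<^esub> q x" by simp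
  qed (use q in simp)
  moreover have "q b = \<zero>\<^bsub>M\<^esub>" if "b \<in> B" for b
    using uniq[of "\<zero>\<^bsub>M\<^esub>" b b] that cA(2) cB(1) by simp
  ultimately show ?thesis using that q by blast
qed

section \<open>Finite generation and finite partial sums of bricks\<close>

text \<open>The images of the standard basis vectors under the surjection from the free module onto
  U generate U. Generation is phrased through the submodules containing G, which avoids a notion of
  span.\<close>

lemma finitely_presented_generators:
  assumes U: "submodule U R M" and fp: "finitely_presented R (M\<lparr>carrier := U\<rparr>)"
  obtains G where "finite G" "G \<subseteq> U" "\<And>H. submodule H R M \<Longrightarrow> G \<subseteq> H \<Longrightarrow> U \<subseteq> H"
proof -
  obtain n g where "g \<in> mod_hom R (free_module R n) (M\<lparr>carrier := U\<rparr>)"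
    and surj: "g ` carrier (free_module R n) = U"
    using fp unfolding finitely_presented_def by auto
  then have g: "linear_map R (free_module R n) (M\<lparr>carrier := U\<rparr>) g"
    by (simp add: mod_hom_linear_map)
  have free: "x \<in> carrier (free_module R n) \<longleftrightarrow> x \<in> {..<n} \<rightarrow>\<^sub>E carrier R" for x
    by (simp add: direct_sum_def regular_module_def)
  define e where "e = (\<lambda>k. \<lambda>i\<in>{..<n}. if i = k then \<one>\<^bsub>R\<^esub> else \<zero>\<^bsub>R\<^esub>)"
  have e: "e k \<in> carrier (free_module R n)" for k
    unfolding free e_def by auto
  have "U \<subseteq> H" if H: "submodule H R M" and GH: "(\<lambda>k. g (e k)) ` {..<n} \<subseteq> H" for H
  proof -
    note cH = submodule_closed[OF H]
    \<comment> \<open>Induction on a bound \<open>m\<close> for the support of \<open>x\<close>; the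
      bound m = n covers the whole free module.\<close>
    have "g x \<in> H" if "m \<le> n" "x \<in> carrier (free_module R n)" "\<And>k. m \<le> k \<Longrightarrow> k < n \<Longrightarrow> x k = \<zero>\<^bsub>R\<^esub>"
      for m x
      using that
    proof (induction m arbitrary: x)
      \<comment> \<open>All coordinates of \<open>x\<close> vanish, so \<open>x\<close> is its own
        multiple by the scalar 0, and compatibility of \<open>g\<close> with scalars makes
        \<open>g x\<close> zero without an appeal to module axioms for the free module.\<close>
      case 0
      have "\<zero>\<^bsub>R\<^esub> \<odot>\<^bsub>free_module R n\<^esub> x = x"
        using 0 unfolding free
        by (auto simp: direct_sum_def regular_module_def fun_eq_iff PiE_iff extensional_def)
      moreover have "g (\<zero>\<^bsub>R\<^esub> \<odot>\<^bsub>free_module R n\<^esub> x) = \<zero>\<^bsub>M\<^esub>"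
        using linear_mapD(3)[OF g R.zero_closed 0(2)] linear_mapD(1)[OF g 0(2)]
          submodule_closed(1)[OF U] smult_zero_left by simp
      ultimately show ?case using cH(2) by simp
    next
      case (Suc m)
      \<comment> \<open>Erasing the last possibly nonzero coordinate gives x = y + x_m e_m, where
        \<open>y\<close> falls under the induction hypothesis.\<close>
      define y where "y = x(m := \<zero>\<^bsub>R\<^esub>)"
      have xm: "x m \<in> carrier R"
        using PiE_mem[OF Suc.prems(2)[unfolded free], of m] Suc.prems(1) by simp
      have y: "y \<in> carrier (free_module R n)"
        using Suc.prems(1,2) unfolding free y_def by (auto simp: PiE_iff extensional_def)
      have ye: "x m \<odot>\<^bsub>free_module R n\<^esub> e m \<in> carrier (free_module R n)"
        using xm unfolding free by (auto simp: direct_sum_def regular_module_def e_def)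
      have "y \<oplus>\<^bsub>free_module R n\<^esub> (x m \<odot>\<^bsub>free_module R n\<^esub> e m) = x"
        using Suc.prems(1,2) xm unfolding free
        by (auto simp: direct_sum_def regular_module_def fun_eq_iff PiE_iff extensional_def y_def e_def)
      then have "g x = g y \<oplus>\<^bsub>M\<^esub> x m \<odot>\<^bsub>M\<^esub> g (e m)"
        using linear_mapD(2)[OF g y ye] linear_mapD(3)[OF g xm e] by simp
      moreover have "g y \<in> H"
      proof (rule Suc.IH[OF _ y])
        show "m \<le> n" using Suc.prems(1) by simp
        show "y k = \<zero>\<^bsub>R\<^esub>" if "m \<le> k" "k < n" for k
          using Suc.prems(3)[of k] that by (cases "k = m") (auto simp: y_def)
      qed
      moreover have "g (e m) \<in> H" using GH Suc.prems(1) by auto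
      ultimately show ?case using cH(3,6) xm by simp
    qed
    from this[of n] show ?thesis using surj by fastforce
  qed
  moreover have "(\<lambda>k. g (e k)) ` {..<n} \<subseteq> U" using linear_mapD(1)[OF g e] by auto
  ultimately show ?thesis using that[of "(\<lambda>k. g (e k)) ` {..<n}"] by blast
qed

text \<open>\<open>E K\<close> is the sum of those bricks in a decomposition of \<open>U\<close> whose index lies in \<open>K\<close>.\<close>

lemma semisimple_layers:
  assumes S: "semibrick R \<X>" and U: "submodule U R M"
    and ss: "semisimple R \<X> (M\<lparr>carrier := U\<rparr>)"
  obtains J :: "'b set" and E :: "'b set \<Rightarrow> 'b set"
  where "\<And>K. submodule (E K) R M" and "\<And>K. E K \<subseteq> U"
    and "\<And>K L. K \<subseteq> L \<Longrightarrow> E K \<subseteq> E L"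
    and "\<And>u. u \<in> U \<Longrightarrow> \<exists>K\<subseteq>J. finite K \<and> u \<in> E K"
    and "E {} = {\<zero>\<^bsub>M\<^esub>}"
    and "\<And>j K w. j \<in> J \<Longrightarrow> w \<in> E (insert j K) \<Longrightarrow> \<exists>u\<in>E K. \<exists>v\<in>E {j}. w = u \<oplus>\<^bsub>M\<^esub> v"
    and "\<And>j K. j \<in> J \<Longrightarrow> j \<notin> K \<Longrightarrow> E {j} \<inter> E K = {\<zero>\<^bsub>M\<^esub>}"
    and "\<And>j. j \<in> J \<Longrightarrow> \<exists>X\<in>\<X>. mod_isomorphic R (M\<lparr>carrier := E {j}\<rparr>) X"
proof -
  note cU = submodule_closed[OF U]
  let ?U = "M\<lparr>carrier := U\<rparr>"
  obtain J :: "'b set" and F h where F: "F \<in> J \<rightarrow> \<X>" and "h \<in> mod_hom R ?U (direct_sum J F)"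
    and hb: "bij_betw h U (carrier (direct_sum J F))"
    using ss unfolding semisimple_def mod_isomorphic_def by auto
  then have h: "linear_map R ?U (direct_sum J F) h" by (simp add: mod_hom_linear_map)
  have Fm: "left_module R (F k)" if "k \<in> J" for k
    using S F that unfolding semibrick_def brick_def by blast
  have Um: "left_module R ?U" by (rule left_module_submodule[OF U])
  have hk: "linear_map R ?U (F k) (\<lambda>u. h u k)" if k: "k \<in> J" for k
  proof (rule linear_mapI)
    fix x assume "x \<in> carrier ?U"
    then show "h x k \<in> carrier (F k)"
      using linear_mapD(1)[OF h] k by (auto simp: direct_sum_def)
  next
    fix x y assume "x \<in> carrier ?U" "y \<in> carrier ?U"
    then show "h (x \<oplus>\<^bsub>?U\<^esub> y) k = h x k \<oplus>\<^bsub>F k\<^esub> h y k"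
      using linear_mapD(2)[OF h, of x y] k by (simp add: direct_sum_def)
  next
    fix a x assume "a \<in> carrier R" "x \<in> carrier ?U"
    then show "h (a \<odot>\<^bsub>?U\<^esub> x) k = a \<odot>\<^bsub>F k\<^esub> h x k"
      using linear_mapD(3)[OF h, of a x] k by (simp add: direct_sum_def)
  qed
  have hz: "h \<zero>\<^bsub>M\<^esub> k = \<zero>\<^bsub>F k\<^esub>" if "k \<in> J" for k
    using linear_map_zero[OF Um Fm[OF that] hk[OF that]] by simp
  have hm: "h (x \<ominus>\<^bsub>M\<^esub> y) k = h x k \<ominus>\<^bsub>F k\<^esub> h y k" if "k \<in> J" "x \<in> U" "y \<in> U" for k x y
  proof -
    \<comment> \<open>Negation in \<open>?U\<close> is defined relative to the carrier U. It agrees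
      with negation in M by uniqueness of additive inverses.\<close>
    interpret Um: left_module R ?U by (rule Um)
    have "\<ominus>\<^bsub>?U\<^esub> y = \<ominus>\<^bsub>M\<^esub> y"
      using cU that by (intro Um.M.minus_equality) (auto simp: M.l_neg)
    then have "x \<ominus>\<^bsub>?U\<^esub> y = x \<ominus>\<^bsub>M\<^esub> y" by (simp add: a_minus_def)
    then show ?thesis
      using linear_map_minus[OF Um Fm[OF that(1)] hk[OF that(1)], of x y] that by simp
  qed
  \<comment> \<open>Families in the direct sum are extensional on J, so equal coordinates on J
    already give \<open>h x = h y\<close>.\<close>
  have inj: "x = y" if "x \<in> U" "y \<in> U" "\<And>k. k \<in> J \<Longrightarrow> h x k = h y k" for x y
  proof -
    have "h x \<in> extensional J" "h y \<in> extensional J"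
      using linear_mapD(1)[OF h] that by (auto simp: direct_sum_def PiE_def)
    then have "h x = h y" using that(3) by (rule extensionalityI)
    then show ?thesis using hb that by (metis bij_betw_def inj_onD)
  qed
  \<comment> \<open>The element is the preimage under \<open>h\<close> of the family concentrated at
    \<open>j\<close> with value \<open>y\<close>.\<close>
  have inv: "\<exists>v\<in>U. \<forall>k\<in>J. h v k = (if k = j then y else \<zero>\<^bsub>F k\<^esub>)"
    if j: "j \<in> J" and y: "y \<in> carrier (F j)" for j y
  proof -
    let ?w = "\<lambda>k\<in>J. if k = j then y else \<zero>\<^bsub>F k\<^esub>"
    have "{k \<in> J. ?w k \<noteq> \<zero>\<^bsub>F k\<^esub>} \<subseteq> {j}" by auto
    then have "finite {k \<in> J. ?w k \<noteq> \<zero>\<^bsub>F k\<^esub>}" by (rule finite_subset) simp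
    then have "?w \<in> carrier (direct_sum J F)"
      using y left_module_zero_closed[OF Fm] by (auto simp: direct_sum_def)
    then have "?w \<in> h ` U" using bij_betw_imp_surj_on[OF hb] by blast
    then obtain v where "v \<in> U" "h v = ?w" by (auto simp del: restrict_apply)
    then show ?thesis by (intro bexI[of _ v]) simp_all
  qed
  \<comment> \<open>The partial sum over K is encoded as the common kernel in U of the coordinates
    outside K, so that no sums in M have to be formed.\<close>
  define E where "E = (\<lambda>K. {u \<in> U. \<forall>k\<in>J - K. h u k = \<zero>\<^bsub>F k\<^esub>})"
  have sub: "submodule (E K) R M" for K
  proof (rule submodule_intro)
    show "E K \<subseteq> carrier M" using cU(1) by (auto simp: E_def)
    show "\<zero>\<^bsub>M\<^esub> \<in> E K" using cU(2) hz by (simp add: E_def)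
  next
    fix x y assume xy: "x \<in> E K" "y \<in> E K"
    have "h (x \<oplus>\<^bsub>M\<^esub> y) k = \<zero>\<^bsub>F k\<^esub>" if "k \<in> J - K" for k
    proof -
      interpret Fk: left_module R "F k" using Fm that by blast
      show ?thesis using linear_mapD(2)[OF hk, of k x y] that xy by (simp add: E_def)
    qed
    then show "x \<oplus>\<^bsub>M\<^esub> y \<in> E K" using xy cU(3) by (simp add: E_def)
  next
    fix a x assume ax: "a \<in> carrier R" "x \<in> E K"
    have "h (a \<odot>\<^bsub>M\<^esub> x) k = \<zero>\<^bsub>F k\<^esub>" if "k \<in> J - K" for k
    proof -
      interpret Fk: left_module R "F k" using Fm that by blast
      show ?thesis using linear_mapD(3)[OF hk, of k a x] that ax
        by (simp add: E_def Fk.smult_zero_right)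
    qed
    then show "a \<odot>\<^bsub>M\<^esub> x \<in> E K" using ax cU(6) by (simp add: E_def)
  qed
  have split: "\<exists>u\<in>E K. \<exists>v\<in>E {j}. w = u \<oplus>\<^bsub>M\<^esub> v"
    if j: "j \<in> J" and w: "w \<in> E (insert j K)" for j K w
  proof -
    have wU: "w \<in> U" using w by (simp add: E_def)
    \<comment> \<open>The summand \<open>v\<close> carries the coordinate of \<open>w\<close> at
      \<open>j\<close> and zeros elsewhere; the other summand is w - v.\<close>
    obtain v where v: "v \<in> U" "\<And>k. k \<in> J \<Longrightarrow> h v k = (if k = j then h w j else \<zero>\<^bsub>F k\<^esub>)"
      using inv[OF j] linear_mapD(1)[OF hk[OF j]] wU by fastforce
    have "h (w \<ominus>\<^bsub>M\<^esub> v) k = \<zero>\<^bsub>F k\<^esub>" if k: "k \<in> J - K" for k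
    proof -
      interpret Fk: left_module R "F k" using Fm k by blast
      have "h w k \<in> carrier (F k)" using linear_mapD(1)[OF hk] k wU by simp
      then have "h w k \<ominus>\<^bsub>F k\<^esub> h w k = \<zero>\<^bsub>F k\<^esub>" by (simp add: a_minus_def Fk.M.r_neg)
      then show ?thesis using hm[of k w v] k v w wU
        by (cases "k = j") (auto simp: E_def a_minus_def)
    qed
    then have "w \<ominus>\<^bsub>M\<^esub> v \<in> E K" using cU(5)[OF wU v(1)] by (simp add: E_def)
    moreover have "v \<in> E {j}" using v by (simp add: E_def)
    moreover have "w = w \<ominus>\<^bsub>M\<^esub> v \<oplus>\<^bsub>M\<^esub> v"
      using cU(1) wU v(1) by (simp add: M.minus_eq M.a_assoc M.l_neg)
    ultimately show ?thesis by blast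
  qed
  \<comment> \<open>The coordinate at \<open>j\<close> is an isomorphism from \<open>E {j}\<close>
    onto \<open>F j\<close>: all other coordinates vanish on \<open>E {j}\<close>, and
    \<open>inv\<close> supplies preimages.\<close>
  have iso: "\<exists>X\<in>\<X>. mod_isomorphic R (M\<lparr>carrier := E {j}\<rparr>) X" if j: "j \<in> J" for j
  proof -
    have Ej: "E {j} \<subseteq> U" by (auto simp: E_def)
    have "linear_map R (M\<lparr>carrier := E {j}\<rparr>) (F j) (\<lambda>u. h u j)"
      using linear_mapD[OF hk[OF j]] Ej by (intro linear_mapI) (auto simp: subset_iff)
    then have "restrict (\<lambda>u. h u j) (E {j}) \<in> mod_hom R (M\<lparr>carrier := E {j}\<rparr>) (F j)"
      using linear_map_mod_hom[OF left_module_submodule[OF sub]] by fastforce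
    moreover have "bij_betw (\<lambda>u. h u j) (E {j}) (carrier (F j))"
    proof (rule bij_betw_imageI)
      show "inj_on (\<lambda>u. h u j) (E {j})"
      proof (rule inj_onI)
        fix x y assume "x \<in> E {j}" "y \<in> E {j}" "h x j = h y j"
        then have "x \<in> U" "y \<in> U" "h x k = h y k" if "k \<in> J" for k
          using that by (cases "k = j"; simp add: E_def)+
        then show "x = y" using j inj by blast
      qed
      show "(\<lambda>u. h u j) ` E {j} = carrier (F j)"
      proof
        show "(\<lambda>u. h u j) ` E {j} \<subseteq> carrier (F j)"
          using linear_mapD(1)[OF hk[OF j]] Ej by auto
        show "carrier (F j) \<subseteq> (\<lambda>u. h u j) ` E {j}"
        proof
          fix y assume "y \<in> carrier (F j)"
          then obtain v where "v \<in> U" "\<forall>k\<in>J. h v k = (if k = j then y else \<zero>\<^bsub>F k\<^esub>)"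
            using inv[OF j] by blast
          then show "y \<in> (\<lambda>u. h u j) ` E {j}"
            using j by (intro image_eqI[of _ _ v]) (auto simp: E_def)
        qed
      qed
    qed
    ultimately have "mod_isomorphic R (M\<lparr>carrier := E {j}\<rparr>) (F j)"
      unfolding mod_isomorphic_def by (intro bexI) simp_all
    then show ?thesis using F j by blast
  qed
  have zero: "x = \<zero>\<^bsub>M\<^esub>" if "x \<in> U" "\<And>k. k \<in> J \<Longrightarrow> h x k = \<zero>\<^bsub>F k\<^esub>" for x
    by (rule inj) (use that hz cU(2) in auto)
  show ?thesis
  proof (rule that[of E J])
    show "submodule (E K) R M" for K by (rule sub)
    show "E K \<subseteq> U" for K by (auto simp: E_def)
    show "K \<subseteq> L \<Longrightarrow> E K \<subseteq> E L" for K L by (auto simp: E_def)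
    \<comment> \<open>The witness is the support of \<open>h u\<close>, finite by the definition of
      the direct sum.\<close>
    show "\<exists>K\<subseteq>J. finite K \<and> u \<in> E K" if "u \<in> U" for u
      using linear_mapD(1)[OF h, of u] that
      by (intro exI[of _ "{k \<in> J. h u k \<noteq> \<zero>\<^bsub>F k\<^esub>}"]) (auto simp: E_def direct_sum_def)
    show "E {} = {\<zero>\<^bsub>M\<^esub>}"
      using zero submodule_closed(2)[OF sub, of "{}"] by (auto simp: E_def)
    show "E {j} \<inter> E K = {\<zero>\<^bsub>M\<^esub>}" if "j \<in> J" "j \<notin> K" for j K
    proof -
      have "x = \<zero>\<^bsub>M\<^esub>" if "x \<in> E {j} \<inter> E K" for x
        by (rule zero) (use that \<open>j \<notin> K\<close> in \<open>auto simp: E_def\<close>)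
      then show ?thesis using submodule_closed(2)[OF sub] by blast
    qed
  qed (use split iso in auto)
qed

end

section \<open>Coordinates in an internal direct sum\<close>

locale internal_sum = left_module R M
  for R :: "('a, 'r) ring_scheme" (structure) and M :: "('a, 'c, 'm) module_scheme" (structure) +
  fixes I :: "'i set" and N :: "'i \<Rightarrow> 'c set"
  assumes internal: "internal_direct_sum R M I N"
begin

text \<open>This is the carrier of the external direct sum in \<open>internal_direct_sum\<close>,
  written out, and \<open>total\<close> below is the summation map from it to M.\<close>

definition families :: "('i \<Rightarrow> 'c) set" where
  "families = {x \<in> \<Pi>\<^sub>E i\<in>I. N i. finite {i \<in> I. x i \<noteq> \<zero>\<^bsub>M\<^esub>}}"

definition total :: "('i \<Rightarrow> 'c) \<Rightarrow> 'c" where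
  "total x = finsum M x {i \<in> I. x i \<noteq> \<zero>\<^bsub>M\<^esub>}"

text \<open>For \<open>i\<close> in I this is the projection of M onto \<open>N i\<close>, obtained
  by inverting the summation map.\<close>

definition coord :: "'i \<Rightarrow> 'c \<Rightarrow> 'c" where
  "coord i x = inv_into families total x i"

text \<open>\<open>part J\<close> is the sum of the components \<open>N i\<close> with \<open>i \<in> J\<close>.\<close>

definition part :: "'i set \<Rightarrow> 'c set" where
  "part J = {x \<in> carrier M. \<forall>i\<in>I - J. coord i x = \<zero>\<^bsub>M\<^esub>}"

lemma total_bij: "bij_betw total families (carrier M)"
  using internal unfolding internal_direct_sum_def total_def[abs_def] families_def
  by (simp add: direct_sum_def)

lemma component: "i \<in> I \<Longrightarrow> submodule (N i) R M"
  using internal unfolding internal_direct_sum_def by blast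

lemma families_closed: "x \<in> families \<Longrightarrow> i \<in> I \<Longrightarrow> x i \<in> carrier M"
  using submodule_closed(1)[OF component] unfolding families_def by auto

text \<open>Indices outside the support contribute zero. Families with different supports can thus
  be summed over a common finite index set.\<close>

lemma total_eq:
  assumes "x \<in> families" "finite A" "{i \<in> I. x i \<noteq> \<zero>\<^bsub>M\<^esub>} \<subseteq> A" "A \<subseteq> I"
  shows "total x = finsum M x A"
  unfolding total_def
  using assms families_closed[OF assms(1)]
  by (intro M.add.finprod_mono_neutral_cong_left) auto

text \<open>All three families are summed over the union of the supports of \<open>x\<close> and
  \<open>y\<close>.\<close>

lemma total_add:
  assumes x: "x \<in> families" and y: "y \<in> families"
  shows "(\<lambda>i\<in>I. x i \<oplus>\<^bsub>M\<^esub> y i) \<in> families"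
    and "total (\<lambda>i\<in>I. x i \<oplus>\<^bsub>M\<^esub> y i) = total x \<oplus>\<^bsub>M\<^esub> total y"
proof -
  let ?z = "\<lambda>i\<in>I. x i \<oplus>\<^bsub>M\<^esub> y i"
  let ?A = "{i \<in> I. x i \<noteq> \<zero>\<^bsub>M\<^esub>} \<union> {i \<in> I. y i \<noteq> \<zero>\<^bsub>M\<^esub>}"
  have fin: "finite ?A" using x y by (simp add: families_def)
  have sub: "{i \<in> I. ?z i \<noteq> \<zero>\<^bsub>M\<^esub>} \<subseteq> ?A" by auto
  have "?z i \<in> N i" if "i \<in> I" for i
    using x y submodule_closed(3)[OF component[OF that]] that unfolding families_def by auto
  then show z: "?z \<in> families"
    using finite_subset[OF sub fin] by (auto simp: families_def)
  have "total ?z = finsum M ?z ?A" by (rule total_eq[OF z fin sub]) auto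
  also have "\<dots> = finsum M (\<lambda>i. x i \<oplus>\<^bsub>M\<^esub> y i) ?A"
    using families_closed[OF x] families_closed[OF y] by (intro M.finsum_cong') auto
  also have "\<dots> = finsum M x ?A \<oplus>\<^bsub>M\<^esub> finsum M y ?A"
    using families_closed[OF x] families_closed[OF y] by (intro M.finsum_addf) auto
  also have "\<dots> = total x \<oplus>\<^bsub>M\<^esub> total y"
    using total_eq[OF x fin] total_eq[OF y fin] by auto
  finally show "total ?z = total x \<oplus>\<^bsub>M\<^esub> total y" .
qed

lemma total_smult:
  assumes a: "a \<in> carrier R" and x: "x \<in> families"
  shows "(\<lambda>i\<in>I. a \<odot>\<^bsub>M\<^esub> x i) \<in> families"
    and "total (\<lambda>i\<in>I. a \<odot>\<^bsub>M\<^esub> x i) = a \<odot>\<^bsub>M\<^esub> total x"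
proof -
  let ?z = "\<lambda>i\<in>I. a \<odot>\<^bsub>M\<^esub> x i"
  let ?A = "{i \<in> I. x i \<noteq> \<zero>\<^bsub>M\<^esub>}"
  have fin: "finite ?A" using x by (simp add: families_def)
  have sub: "{i \<in> I. ?z i \<noteq> \<zero>\<^bsub>M\<^esub>} \<subseteq> ?A" by (auto simp: smult_zero_right a)
  have "?z i \<in> N i" if "i \<in> I" for i
    using x submodule_closed(6)[OF component[OF that] a] that unfolding families_def by auto
  then show z: "?z \<in> families"
    using finite_subset[OF sub fin] by (auto simp: families_def)
  have "total ?z = finsum M ?z ?A" by (rule total_eq[OF z fin sub]) auto
  also have "\<dots> = finsum M (\<lambda>i. a \<odot>\<^bsub>M\<^esub> x i) ?A"
    using families_closed[OF x] smult_closed[OF a] by (intro M.finsum_cong') auto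
  also have "\<dots> = a \<odot>\<^bsub>M\<^esub> finsum M x ?A"
    using families_closed[OF x] fin by (intro smult_sum[OF a, symmetric]) auto
  also have "\<dots> = a \<odot>\<^bsub>M\<^esub> total x" by (simp add: total_def)
  finally show "total ?z = a \<odot>\<^bsub>M\<^esub> total x" .
qed

lemma coord_total: "x \<in> families \<Longrightarrow> coord i (total x) = x i"
  unfolding coord_def using bij_betw_inv_into_left[OF total_bij] by simp

lemma family_of:
  assumes "x \<in> carrier M"
  obtains y where "y \<in> families" "total y = x" "\<And>i. coord i x = y i"
proof -
  have "inv_into families total x \<in> families"
    using assms total_bij by (metis bij_betw_def inv_into_into)
  then show ?thesis
    using that[of "inv_into families total x"] bij_betw_inv_into_right[OF total_bij assms]
    by (simp add: coord_def)
qed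

lemma linear_map_coord:
  assumes i: "i \<in> I"
  shows "linear_map R M (M\<lparr>carrier := N i\<rparr>) (coord i)"
proof (rule linear_mapI)
  fix x assume "x \<in> carrier M"
  then obtain y where "y \<in> families" "\<And>i. coord i x = y i" by (rule family_of) blast
  then show "coord i x \<in> carrier (M\<lparr>carrier := N i\<rparr>)" using i by (auto simp: families_def)
next
  fix x y assume x: "x \<in> carrier M" and y: "y \<in> carrier M"
  obtain x' where x': "x' \<in> families" "total x' = x" "\<And>i. coord i x = x' i"
    using x by (rule family_of) blast
  obtain y' where y': "y' \<in> families" "total y' = y" "\<And>i. coord i y = y' i"
    using y by (rule family_of) blast
  show "coord i (x \<oplus>\<^bsub>M\<^esub> y) = coord i x \<oplus>\<^bsub>M\<lparr>carrier := N i\<rparr>\<^esub> coord i y"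
    using coord_total[OF total_add(1)[OF x'(1) y'(1)], of i] total_add(2)[OF x'(1) y'(1)]
      x' y' i by simp
next
  fix a x assume a: "a \<in> carrier R" and x: "x \<in> carrier M"
  obtain x' where x': "x' \<in> families" "total x' = x" "\<And>i. coord i x = x' i"
    using x by (rule family_of) blast
  show "coord i (a \<odot>\<^bsub>M\<^esub> x) = a \<odot>\<^bsub>M\<lparr>carrier := N i\<rparr>\<^esub> coord i x"
    using coord_total[OF total_smult(1)[OF a x'(1)], of i] total_smult(2)[OF a x'(1)] x' i by simp
qed

lemma linear_map_coord_M: "i \<in> I \<Longrightarrow> linear_map R M M (coord i)"
  using linear_map_into_submodule[OF component linear_map_coord] by blast

text \<open>The family of \<open>x\<close> has empty support, so its sum is empty. Used in
  contrapositive form, this finds the component that takes part in an exchange.\<close>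

lemma coord_eq_zero:
  assumes x: "x \<in> carrier M" and c: "\<And>i. i \<in> I \<Longrightarrow> coord i x = \<zero>\<^bsub>M\<^esub>"
  shows "x = \<zero>\<^bsub>M\<^esub>"
proof -
  obtain y where y: "total y = x" "\<And>i. coord i x = y i" using x by (rule family_of) blast
  then have "{i \<in> I. y i \<noteq> \<zero>\<^bsub>M\<^esub>} = {}" using c by auto
  then show ?thesis using y(1) unfolding total_def by (metis M.finsum_empty)
qed

lemma submodule_part: "submodule (part J) R M"
proof (rule submodule_intro)
  show "\<zero>\<^bsub>M\<^esub> \<in> part J"
    using linear_map_zero[OF left_module_self left_module_self linear_map_coord_M]
    by (simp add: part_def)
next
  fix x y assume "x \<in> part J" "y \<in> part J"
  then show "x \<oplus>\<^bsub>M\<^esub> y \<in> part J"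
    using linear_mapD(2)[OF linear_map_coord_M] by (auto simp: part_def)
next
  fix a x assume "a \<in> carrier R" "x \<in> part J"
  then show "a \<odot>\<^bsub>M\<^esub> x \<in> part J"
    using linear_mapD(3)[OF linear_map_coord_M] smult_closed smult_zero_right
    by (auto simp: part_def)
qed (auto simp: part_def)

lemma part_mono: "J \<subseteq> J' \<Longrightarrow> part J \<subseteq> part J'"
  by (auto simp: part_def)

text \<open>A family over the enlarged index set amounts to an element of U, its value at
  \<open>None\<close>, and a family over \<open>I'\<close>, whose sum lies in
  \<open>part I'\<close>. Summation is therefore bijective because every element of M splits
  uniquely along \<open>part I'\<close> and U.\<close>

lemma internal_direct_sum_complement:
  assumes I': "I' \<subseteq> I" and U: "submodule U R M" and comp: "complementary (part I') U"
  shows "internal_direct_sum R M (insert None (Some ` I'))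
    (\<lambda>k. case k of None \<Rightarrow> U | Some i \<Rightarrow> N i)"
proof -
  let ?I = "insert None (Some ` I')"
  let ?N = "\<lambda>k. case k of None \<Rightarrow> U | Some i \<Rightarrow> N i"
  \<comment> \<open>\<open>D\<close> and \<open>S\<close> are the domain and the summation map of
    the direct sum to be established; \<open>r x\<close> is the part of \<open>x\<close> at the
    indices \<open>Some i\<close>, extended by zero to all of I.\<close>
  define D where "D = {x \<in> \<Pi>\<^sub>E k\<in>?I. ?N k. finite {k \<in> ?I. x k \<noteq> \<zero>\<^bsub>M\<^esub>}}"
  define S where "S = (\<lambda>x. finsum M x {k \<in> ?I. x k \<noteq> \<zero>\<^bsub>M\<^esub>})"
  define r where "r = (\<lambda>x :: 'i option \<Rightarrow> 'c. \<lambda>i\<in>I. if i \<in> I' then x (Some i) else \<zero>\<^bsub>M\<^esub>)"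
  note cU = submodule_closed[OF U]
  have D: "x None \<in> U" "r x \<in> families" "total (r x) \<in> part I'" "S x = total (r x) \<oplus>\<^bsub>M\<^esub> x None"
    if x: "x \<in> D" for x
  proof -
    show xU: "x None \<in> U" using x by (auto simp: D_def PiE_iff)
    have xN: "x (Some i) \<in> N i" if "i \<in> I'" for i
      using x that by (auto simp: D_def PiE_iff)
    let ?A = "{i \<in> I'. x (Some i) \<noteq> \<zero>\<^bsub>M\<^esub>}"
    have "finite (Some ` ?A)"
      using x by (auto simp: D_def intro: finite_subset[rotated])
    then have finA: "finite ?A" by (simp add: finite_image_iff)
    have supp: "{i \<in> I. r x i \<noteq> \<zero>\<^bsub>M\<^esub>} = ?A" using I' by (auto simp: r_def)
    then show rx: "r x \<in> families"
      using finA xN submodule_closed(2)[OF component] by (auto simp: families_def r_def)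
    have "total (r x) \<in> carrier M" using total_bij rx by (auto simp: bij_betw_def)
    then show "total (r x) \<in> part I'"
      using coord_total[OF rx] by (auto simp: part_def r_def)
    have xM: "x (Some i) \<in> carrier M" if "i \<in> I'" for i
      using xN[OF that] submodule_closed(1)[OF component] I' that by blast
    \<comment> \<open>The index \<open>None\<close> may be added to the support: where it is
      missing, \<open>x None\<close> is zero.\<close>
    have "S x = finsum M x (insert None (Some ` ?A))"
      unfolding S_def using finA xM cU(1)[OF xU]
      by (intro M.add.finprod_mono_neutral_cong_left) auto
    also have "\<dots> = x None \<oplus>\<^bsub>M\<^esub> finsum M x (Some ` ?A)"
      using finA xM cU(1)[OF xU] by (intro M.finsum_insert) auto
    also have "finsum M x (Some ` ?A) = finsum M (\<lambda>i. x (Some i)) ?A"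
      using xM by (intro M.finsum_reindex) auto
    also have "\<dots> = total (r x)"
      unfolding total_def supp using xM I' by (intro M.finsum_cong') (auto simp: r_def)
    finally show "S x = total (r x) \<oplus>\<^bsub>M\<^esub> x None"
      using cU(1)[OF xU] \<open>total (r x) \<in> carrier M\<close> by (simp add: M.a_comm)
  qed
  have "inj_on S D"
  proof (rule inj_onI)
    fix x y assume x: "x \<in> D" and y: "y \<in> D" and "S x = S y"
    then have "total (r x) = total (r y) \<and> x None = y None"
      using disjoint_sum_unique[OF submodule_part U, of I'] D comp
      unfolding complementary_def by metis
    then have "r x = r y" "x None = y None"
      using total_bij D(2)[OF x] D(2)[OF y] by (auto simp: bij_betw_def dest: inj_onD)
    then have "x k = y k" if "k \<in> ?I" for k
      using that I' by (auto simp: r_def fun_eq_iff split: if_splits)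
    then show "x = y"
      using x y by (intro extensionalityI[of _ ?I]) (auto simp: D_def PiE_def)
  qed
  moreover have "S ` D = carrier M"
  proof
    show "S ` D \<subseteq> carrier M"
    proof (rule image_subsetI)
      fix x assume "x \<in> D"
      from D[OF this] show "S x \<in> carrier M"
        using submodule_closed(1)[OF submodule_part] cU(1) by simp
    qed
    show "carrier M \<subseteq> S ` D"
    proof
      fix m assume "m \<in> carrier M"
      then obtain s u where s: "s \<in> part I'" and u: "u \<in> U" and m: "m = s \<oplus>\<^bsub>M\<^esub> u"
        using comp unfolding complementary_def by metis
      have sM: "s \<in> carrier M" using s by (simp add: part_def)
      obtain y where y: "y \<in> families" "total y = s" "\<And>i. coord i s = y i"
        using sM by (rule family_of) blast
      \<comment> \<open>The value at \<open>None\<close> is \<open>u\<close>, and the other values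
        are the coordinates of \<open>s\<close> with index in \<open>I'\<close>. Since
        \<open>s\<close> lies in \<open>part I'\<close>, its remaining coordinates vanish, and so
        \<open>r x = y\<close>.\<close>
      define x where "x = (\<lambda>k\<in>?I. case k of None \<Rightarrow> u | Some i \<Rightarrow> y i)"
      have "{k \<in> ?I. x k \<noteq> \<zero>\<^bsub>M\<^esub>} \<subseteq> insert None (Some ` {i \<in> I. y i \<noteq> \<zero>\<^bsub>M\<^esub>})"
        using I' by (auto simp: x_def)
      then have "finite {k \<in> ?I. x k \<noteq> \<zero>\<^bsub>M\<^esub>}"
        using y(1) by (auto simp: families_def intro: finite_subset)
      moreover have "y i \<in> N i" if "i \<in> I'" for i
        using y(1) I' that by (auto simp: families_def)
      ultimately have x: "x \<in> D" using u by (auto simp: D_def x_def)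
      have "y i = \<zero>\<^bsub>M\<^esub>" if "i \<in> I" "i \<notin> I'" for i
        using s y(3) that by (simp add: part_def)
      then have "r x = y"
        using y(1) by (intro extensionalityI[of _ I]) (auto simp: r_def x_def families_def PiE_def)
      then have "S x = m" using D(4)[OF x] y(2) m by (simp add: x_def)
      then show "m \<in> S ` D" using x by blast
    qed
  qed
  ultimately have "bij_betw S D (carrier M)" by (simp add: bij_betw_def)
  moreover have "carrier (direct_sum ?I (\<lambda>k. M\<lparr>carrier := ?N k\<rparr>)) = D"
    by (simp add: direct_sum_def D_def)
  moreover have "\<forall>k\<in>?I. submodule (?N k) R M" using U component I' by auto
  ultimately show ?thesis unfolding internal_direct_sum_def S_def by simp
qed

end

section \<open>Steinitz exchange with bricks\<close>

locale brick_sum = internal_sum R M I N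
  for R :: "('a, 'r) ring_scheme" (structure) and M :: "('a, 'c, 'm) module_scheme" (structure)
    and I :: "'i set" and N :: "'i \<Rightarrow> 'c set" +
  fixes \<X> :: "('a, 'b, 'x) module_scheme set"
  assumes semibrick: "semibrick R \<X>"
    and component_brick: "i \<in> I \<Longrightarrow> \<exists>X\<in>\<X>. mod_isomorphic R (M\<lparr>carrier := N i\<rparr>) X"
begin

text \<open>Let \<open>q\<close> be the projection onto \<open>part I'\<close> along U. An element
  of V outside U has a nonzero image under \<open>q\<close>, hence a nonzero coordinate there, and
  its index lies in \<open>I'\<close> because the other coordinates vanish on
  \<open>part I'\<close>. Schur's lemma makes the resulting map from V to \<open>N i\<close>
  bijective.\<close>

lemma brick_exchange:
  assumes I': "I' \<subseteq> I" and U: "submodule U R M" and comp: "complementary (part I') U"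
    and V: "submodule V R M" and VX: "\<exists>X\<in>\<X>. mod_isomorphic R (M\<lparr>carrier := V\<rparr>) X"
    and VU: "\<not> V \<subseteq> U"
  obtains i q where "i \<in> I'" and "linear_map R M (M\<lparr>carrier := part I'\<rparr>) q"
    and "\<And>x. x \<in> carrier M \<Longrightarrow> \<exists>u\<in>U. q x \<oplus>\<^bsub>M\<^esub> u = x"
    and "\<And>u. u \<in> U \<Longrightarrow> q u = \<zero>\<^bsub>M\<^esub>"
    and "bij_betw (\<lambda>x. coord i (q x)) V (N i)"
proof -
  obtain q where q: "linear_map R M (M\<lparr>carrier := part I'\<rparr>) q"
    and q1: "\<And>x. x \<in> carrier M \<Longrightarrow> \<exists>u\<in>U. q x \<oplus>\<^bsub>M\<^esub> u = x"
    and q0: "\<And>u. u \<in> U \<Longrightarrow> q u = \<zero>\<^bsub>M\<^esub>"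
    using complementary_projection[OF submodule_part U comp] by blast
  obtain v where v: "v \<in> V" "v \<notin> U" using VU by blast
  then have vM: "v \<in> carrier M" using submodule_closed(1)[OF V] by blast
  have "q v \<noteq> \<zero>\<^bsub>M\<^esub>"
    using q1[OF vM] v(2) submodule_closed(1)[OF U] by auto
  moreover have qv: "q v \<in> part I'" using linear_mapD(1)[OF q vM] by simp
  ultimately obtain i where i: "i \<in> I'" and nz: "coord i (q v) \<noteq> \<zero>\<^bsub>M\<^esub>"
    using coord_eq_zero[of "q v"] by (auto simp: part_def)
  have iI: "i \<in> I" using i I' by blast
  have "linear_map R M (M\<lparr>carrier := N i\<rparr>) (\<lambda>x. coord i (q x))"
    using linear_map_compose[OF linear_map_into_submodule[OF submodule_part q] linear_map_coord[OF iI]] .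
  from semibrick_schur[OF semibrick left_module_submodule[OF V]
      left_module_submodule[OF component[OF iI]] VX component_brick[OF iI]
      linear_map_from_submodule[OF V this]]
  have "bij_betw (\<lambda>x. coord i (q x)) V (N i)" using v(1) nz by auto
  then show ?thesis using that i q q1 q0 by blast
qed

text \<open>The hypotheses on W say that W = U + V. The map that takes \<open>x\<close> to
  \<open>coord i (q x)\<close> vanishes on U and is bijective from V to \<open>N i\<close>, so V can
  replace the component \<open>N i\<close>.\<close>

lemma complementary_add_brick:
  assumes I': "I' \<subseteq> I" and U: "submodule U R M" and comp: "complementary (part I') U"
    and V: "submodule V R M" and VX: "\<exists>X\<in>\<X>. mod_isomorphic R (M\<lparr>carrier := V\<rparr>) X"
    and VU: "\<not> V \<subseteq> U"
    and W: "submodule W R M" "U \<subseteq> W" "V \<subseteq> W"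
    and WUV: "\<And>w. w \<in> W \<Longrightarrow> \<exists>u\<in>U. \<exists>v\<in>V. w = u \<oplus>\<^bsub>M\<^esub> v"
  obtains i where "i \<in> I'" "complementary (part (I' - {i})) W"
proof -
  obtain i q where i: "i \<in> I'" and q: "linear_map R M (M\<lparr>carrier := part I'\<rparr>) q"
    and q1: "\<And>x. x \<in> carrier M \<Longrightarrow> \<exists>u\<in>U. q x \<oplus>\<^bsub>M\<^esub> u = x"
    and q0: "\<And>u. u \<in> U \<Longrightarrow> q u = \<zero>\<^bsub>M\<^esub>"
    and bij: "bij_betw (\<lambda>x. coord i (q x)) V (N i)"
    by (rule brick_exchange[OF I' U comp V VX VU]) blast
  have iI: "i \<in> I" using i I' by blast
  note cU = submodule_closed[OF U] and cV = submodule_closed[OF V] and cW = submodule_closed[OF W(1)]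
  note cP = submodule_closed[OF submodule_part[of "I' - {i}"]]
  note qM = linear_map_into_submodule[OF submodule_part q]
  note ciM = linear_map_coord_M[OF iI]
  \<comment> \<open>For x = u + v in \<open>part (I' - {i})\<close> one has q x = x, as
    \<open>x\<close> lies in \<open>part I'\<close>, and also q x = q v. The coordinate of q v at
    \<open>i\<close> is therefore zero, so v = 0 by injectivity on V, and \<open>x\<close> lies in
    both U and \<open>part I'\<close>.\<close>
  have disj: "x = \<zero>\<^bsub>M\<^esub>" if x: "x \<in> part (I' - {i})" "x \<in> W" for x
  proof -
    obtain u v where uv: "u \<in> U" "v \<in> V" "x = u \<oplus>\<^bsub>M\<^esub> v" using WUV x(2) by blast
    have m: "u \<in> carrier M" "v \<in> carrier M" "x \<in> carrier M" using uv cU(1) cV(1) by auto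
    have xI: "x \<in> part I'" using x(1) part_mono[of "I' - {i}" I'] by blast
    have qv: "q v \<in> part I'" "q v \<in> carrier M"
      using linear_mapD(1)[OF q m(2)] linear_mapD(1)[OF qM m(2)] by auto
    have "q x = q v"
      using linear_mapD(2)[OF qM m(1,2)] q0[OF uv(1)] uv(3) qv by simp
    moreover have "q x = x"
    proof -
      obtain u' where "u' \<in> U" "q x \<oplus>\<^bsub>M\<^esub> u' = x" using q1[OF m(3)] by blast
      moreover have "q x \<in> part I'" using linear_mapD(1)[OF q m(3)] by simp
      ultimately show ?thesis
        using disjoint_sum_unique[OF submodule_part U, of I' "q x" x u' "\<zero>\<^bsub>M\<^esub>"] comp xI m(3) cU(2)
        unfolding complementary_def by simp
    qed
    moreover have "coord i x = \<zero>\<^bsub>M\<^esub>" using x(1) iI by (simp add: part_def)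
    moreover have "coord i (q \<zero>\<^bsub>M\<^esub>) = \<zero>\<^bsub>M\<^esub>"
      using linear_map_zero[OF left_module_self left_module_self ciM] q0[OF cU(2)] by simp
    ultimately have "v = \<zero>\<^bsub>M\<^esub>"
      using bij uv(2) cV(2) by (metis (mono_tags, lifting) bij_betw_def inj_onD)
    then have "x \<in> U" using uv m by simp
    then show ?thesis using xI comp unfolding complementary_def by blast
  qed
  \<comment> \<open>Surjectivity onto \<open>N i\<close> gives \<open>v\<close> in V such that q v
    and q x have the same coordinate at \<open>i\<close>. Then q (x - v) lies in
    \<open>part (I' - {i})\<close> and differs from x - v by an element of U.\<close>
  have "\<exists>a\<in>part (I' - {i}). \<exists>b\<in>W. x = a \<oplus>\<^bsub>M\<^esub> b" if x: "x \<in> carrier M" for x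
  proof -
    have qx: "q x \<in> part I'" "q x \<in> carrier M"
      using linear_mapD(1)[OF q x] linear_mapD(1)[OF qM x] by auto
    then have "coord i (q x) \<in> N i" using linear_mapD(1)[OF linear_map_coord[OF iI]] by simp
    then obtain v where v: "v \<in> V" "coord i (q v) = coord i (q x)"
      using bij by (metis (mono_tags, lifting) bij_betw_def imageE)
    let ?y = "x \<ominus>\<^bsub>M\<^esub> v"
    have m: "v \<in> carrier M" "?y \<in> carrier M" using v cV(1) x by auto
    have qy: "q ?y \<in> part I'" using linear_mapD(1)[OF q m(2)] by simp
    have "coord i (q ?y) = \<zero>\<^bsub>M\<^esub>"
      using linear_map_minus[OF left_module_self left_module_self linear_map_compose[OF qM ciM] x m(1)]
        v(2) linear_mapD(1)[OF ciM qx(2)] by (simp add: M.minus_eq M.r_neg)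
    then have "q ?y \<in> part (I' - {i})" using qy by (auto simp: part_def)
    moreover obtain u where u: "u \<in> U" "q ?y \<oplus>\<^bsub>M\<^esub> u = ?y" using q1[OF m(2)] by blast
    moreover have "u \<oplus>\<^bsub>M\<^esub> v \<in> W" using u(1) v(1) W(2,3) cW(3) by blast
    moreover have "x = q ?y \<oplus>\<^bsub>M\<^esub> (u \<oplus>\<^bsub>M\<^esub> v)"
    proof -
      have "q ?y \<oplus>\<^bsub>M\<^esub> (u \<oplus>\<^bsub>M\<^esub> v) = (q ?y \<oplus>\<^bsub>M\<^esub> u) \<oplus>\<^bsub>M\<^esub> v"
        using linear_mapD(1)[OF qM m(2)] cU(1)[OF u(1)] m(1) by (simp add: M.a_assoc)
      also have "\<dots> = x \<ominus>\<^bsub>M\<^esub> v \<oplus>\<^bsub>M\<^esub> v" by (simp only: u(2))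
      also have "\<dots> = x" using x m(1) by (simp add: M.minus_eq M.a_assoc M.l_neg)
      finally show ?thesis by simp
    qed
    ultimately show ?thesis by blast
  qed
  then have "complementary (part (I' - {i})) W"
    unfolding complementary_def using disj cP(2) cW(2) by blast
  then show ?thesis using that i by blast
qed

section \<open>Complements of finite partial sums\<close>

text \<open>A brick is nonzero, and an isomorphism preserves this. Together with trivial
  intersection it shows that a new layer is not contained in the sum of the earlier ones.\<close>

lemma brick_submodule_nonzero:
  assumes V: "submodule V R M" and VX: "\<exists>X\<in>\<X>. mod_isomorphic R (M\<lparr>carrier := V\<rparr>) X"
  shows "V \<noteq> {\<zero>\<^bsub>M\<^esub>}"
proof
  assume Vz: "V = {\<zero>\<^bsub>M\<^esub>}"
  obtain X p where X: "X \<in> \<X>" and p: "p \<in> mod_hom R (M\<lparr>carrier := V\<rparr>) X"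
    and pb: "bij_betw p V (carrier X)"
    using VX unfolding mod_isomorphic_def by auto
  have Xb: "brick R X" and Xm: "left_module R X"
    using semibrick X unfolding semibrick_def brick_def by auto
  have "p \<zero>\<^bsub>M\<^esub> = \<zero>\<^bsub>X\<^esub>"
    using linear_map_zero[OF left_module_submodule[OF V] Xm mod_hom_linear_map[OF p]] by simp
  then have "carrier X = {\<zero>\<^bsub>X\<^esub>}" using pb Vz by (auto simp: bij_betw_def)
  then show False using brick_nonzero[OF Xb] by blast
qed

text \<open>Induction on K: each new brick \<open>E {j}\<close> meets \<open>E K\<close> only in
  zero but is itself nonzero, so it can be exchanged for some \<open>N i\<close>, whose index is
  removed from \<open>I'\<close>.\<close>

lemma layers_complement:
  assumes sub: "\<And>K. submodule (E K) R M"
    and mono: "\<And>K L. K \<subseteq> L \<Longrightarrow> E K \<subseteq> E L"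
    and empty: "E {} = {\<zero>\<^bsub>M\<^esub>}"
    and split: "\<And>j K w. j \<in> J \<Longrightarrow> w \<in> E (insert j K) \<Longrightarrow> \<exists>u\<in>E K. \<exists>v\<in>E {j}. w = u \<oplus>\<^bsub>M\<^esub> v"
    and disj: "\<And>j K. j \<in> J \<Longrightarrow> j \<notin> K \<Longrightarrow> E {j} \<inter> E K = {\<zero>\<^bsub>M\<^esub>}"
    and layer: "\<And>j. j \<in> J \<Longrightarrow> \<exists>X\<in>\<X>. mod_isomorphic R (M\<lparr>carrier := E {j}\<rparr>) X"
    and K: "finite K" "K \<subseteq> J"
  shows "\<exists>I'\<subseteq>I. complementary (part I') (E K)"
  using K
proof (induction K rule: finite_induct)
  \<comment> \<open>The induction starts with all of I: no condition on coordinates remains, so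
    \<open>part I\<close> is the carrier of M.\<close>
  case empty
  have "complementary (part I) (E {})"
    unfolding complementary_def assms(3)
    using submodule_closed(2)[OF submodule_part] by (auto simp: part_def)
  then show ?case by blast
next
  case (insert j K)
  then obtain I' where I': "I' \<subseteq> I" "complementary (part I') (E K)" by blast
  have j: "j \<in> J" "j \<notin> K" using insert by auto
  have nsub: "\<not> E {j} \<subseteq> E K"
    using disj[OF j] brick_submodule_nonzero[OF sub layer[OF j(1)]] by blast
  have EK: "E K \<subseteq> E (insert j K)" "E {j} \<subseteq> E (insert j K)" by (auto intro!: mono)
  obtain i where "complementary (part (I' - {i})) (E (insert j K))"
    using complementary_add_brick[OF I'(1) sub I'(2) sub layer[OF j(1)] nsub sub EK
        split[OF j(1)]] by blast
  then show ?case using I'(1) by (intro exI[of _ "I' - {i}"]) blast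
qed

text \<open>Each element of G lies in a finite partial sum of the bricks of U. The union of the
  finitely many index sets is finite and gives a partial sum W that contains G.\<close>

lemma finite_subset_complement:
  assumes U: "submodule U R M" and ss: "semisimple R \<X> (M\<lparr>carrier := U\<rparr>)"
    and G: "finite G" "G \<subseteq> U"
  obtains W I' where "submodule W R M" "G \<subseteq> W" "W \<subseteq> U" "I' \<subseteq> I" "complementary (part I') W"
proof (rule semisimple_layers[OF semibrick U ss])
  fix J :: "'c set" and E :: "'c set \<Rightarrow> 'c set"
  assume E: "\<And>K. submodule (E K) R M" "\<And>K. E K \<subseteq> U"
    "\<And>K L. K \<subseteq> L \<Longrightarrow> E K \<subseteq> E L"
    "\<And>u. u \<in> U \<Longrightarrow> \<exists>K\<subseteq>J. finite K \<and> u \<in> E K"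
    and rest: "E {} = {\<zero>\<^bsub>M\<^esub>}"
    "\<And>j K w. j \<in> J \<Longrightarrow> w \<in> E (insert j K) \<Longrightarrow> \<exists>u\<in>E K. \<exists>v\<in>E {j}. w = u \<oplus>\<^bsub>M\<^esub> v"
    "\<And>j K. j \<in> J \<Longrightarrow> j \<notin> K \<Longrightarrow> E {j} \<inter> E K = {\<zero>\<^bsub>M\<^esub>}"
    "\<And>j. j \<in> J \<Longrightarrow> \<exists>X\<in>\<X>. mod_isomorphic R (M\<lparr>carrier := E {j}\<rparr>) X"
  obtain k where k: "\<And>u. u \<in> U \<Longrightarrow> k u \<subseteq> J \<and> finite (k u) \<and> u \<in> E (k u)"
    using E(4) by metis
  let ?K = "\<Union> (k ` G)"
  have GK: "G \<subseteq> E ?K"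
  proof
    fix u assume u: "u \<in> G"
    then have "E (k u) \<subseteq> E ?K" by (intro E(3)) blast
    then show "u \<in> E ?K" using k u G(2) by blast
  qed
  have "\<exists>I'\<subseteq>I. complementary (part I') (E ?K)"
  proof (rule layers_complement[OF E(1) E(3) rest])
    show "finite ?K" "?K \<subseteq> J" using k G by blast+
  qed
  then show thesis using that[OF E(1) GK E(2)] by blast
qed

text \<open>For a finite generating set G, the complemented partial sum W with G \<subseteq> W
  \<subseteq> U must be all of U.\<close>

lemma finitely_presented_complement:
  assumes U: "submodule U R M" and fp: "finitely_presented R (M\<lparr>carrier := U\<rparr>)"
    and ss: "semisimple R \<X> (M\<lparr>carrier := U\<rparr>)"
  shows "\<exists>I'\<subseteq>I. complementary (part I') U"
proof -
  obtain G where G: "finite G" "G \<subseteq> U" "\<And>H. submodule H R M \<Longrightarrow> G \<subseteq> H \<Longrightarrow> U \<subseteq> H"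
    using finitely_presented_generators[OF U fp] by blast
  obtain W I' where W: "submodule W R M" "G \<subseteq> W" "W \<subseteq> U"
    and I': "I' \<subseteq> I" "complementary (part I') W"
    using finite_subset_complement[OF U ss G(1,2)] by blast
  have "W = U" using G(3)[OF W(1,2)] W(3) by blast
  then show ?thesis using I' by blast
qed

text \<open>A nonzero \<open>v\<close> in both V and U lies in a complemented partial sum W of U. If
  V were not contained in W, the exchange would give a map that is injective on V and takes equal
  values at \<open>v\<close> and at zero.\<close>

lemma brick_subset_semisimple:
  assumes V: "submodule V R M" and VX: "\<exists>X\<in>\<X>. mod_isomorphic R (M\<lparr>carrier := V\<rparr>) X"
    and U: "submodule U R M" and ss: "semisimple R \<X> (M\<lparr>carrier := U\<rparr>)"
    and VU: "V \<inter> U \<noteq> {\<zero>\<^bsub>M\<^esub>}"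
  shows "V \<subseteq> U"
proof -
  obtain v where v: "v \<in> V" "v \<in> U" "v \<noteq> \<zero>\<^bsub>M\<^esub>"
    using VU submodule_closed(2)[OF V] submodule_closed(2)[OF U] by blast
  obtain W I' where W: "submodule W R M" "{v} \<subseteq> W" "W \<subseteq> U"
    and I': "I' \<subseteq> I" "complementary (part I') W"
    using finite_subset_complement[OF U ss, of "{v}"] v(2) by blast
  have "V \<subseteq> W"
  proof (rule ccontr)
    assume "\<not> V \<subseteq> W"
    then obtain i q where q0: "\<And>u. u \<in> W \<Longrightarrow> q u = \<zero>\<^bsub>M\<^esub>"
      and bij: "bij_betw (\<lambda>x. coord i (q x)) V (N i)"
      by (rule brick_exchange[OF I'(1) W(1) I'(2) V VX]) blast
    have "q v = q \<zero>\<^bsub>M\<^esub>" using q0 W(2) submodule_closed(2)[OF W(1)] by simp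
    then have "v = \<zero>\<^bsub>M\<^esub>"
      using inj_onD[OF bij_betw_imp_inj_on[OF bij], of v "\<zero>\<^bsub>M\<^esub>"] v(1) submodule_closed(2)[OF V]
      by simp
    then show False using v(3) by blast
  qed
  then show ?thesis using W(3) by blast
qed

end

theorem lemma3p4:
  fixes R :: "('a, 'r) ring_scheme"
    and \<X> :: "('a, 'b, 'x) module_scheme set"
    and M :: "('a, 'c, 'm) module_scheme"
    and I :: "'i set" and N :: "'i \<Rightarrow> 'c set"
  assumes "ring R"
    and "semibrick R \<X>"
    and "left_module R M"
    and "semisimple R \<X> M"
    and "internal_direct_sum R M I N"
    and "\<And>i. i \<in> I \<Longrightarrow> \<exists>X\<in>\<X>. mod_isomorphic R (M\<lparr>carrier := N i\<rparr>) X"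
  shows "(\<forall>U. submodule U R M \<and> finitely_presented R (M\<lparr>carrier := U\<rparr>)
              \<and> semisimple R \<X> (M\<lparr>carrier := U\<rparr>)
            \<longrightarrow> (\<exists>I'\<subseteq>I. internal_direct_sum R M (insert None (Some ` I'))
                          (\<lambda>k. case k of None \<Rightarrow> U | Some i \<Rightarrow> N i)))
       \<and> (\<forall>V U. submodule V R M \<and> (\<exists>X\<in>\<X>. mod_isomorphic R (M\<lparr>carrier := V\<rparr>) X)
              \<and> submodule U R M \<and> semisimple R \<X> (M\<lparr>carrier := U\<rparr>)
              \<and> V \<inter> U \<noteq> {\<zero>\<^bsub>M\<^esub>}
            \<longrightarrow> V \<subseteq> U)"
proof -
  interpret brick_sum R M I N \<X>
    using assms by (intro brick_sum.intro internal_sum.intro internal_sum_axioms.intro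
        brick_sum_axioms.intro)
  show ?thesis
  proof (intro conjI allI impI; elim conjE)
    fix U assume U: "submodule U R M" and "finitely_presented R (M\<lparr>carrier := U\<rparr>)"
      and "semisimple R \<X> (M\<lparr>carrier := U\<rparr>)"
    then obtain I' where I': "I' \<subseteq> I" "complementary (part I') U"
      using finitely_presented_complement by blast
    show "\<exists>I'\<subseteq>I. internal_direct_sum R M (insert None (Some ` I'))
        (\<lambda>k. case k of None \<Rightarrow> U | Some i \<Rightarrow> N i)"
      using internal_direct_sum_complement[OF I'(1) U I'(2)] I'(1) by blast
  qed (rule brick_subset_semisimple)
qed

end
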